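(* Let $\mathbb C_+=\{z\in\mathbb C:\operatorname{Im} z>0\}$ and let $\nu\in\mathcal A[0,\pi]$. If a subharmonic function $u$ in $\mathbb C_+$ satisfies $$\limsup_{z\to x_0,\ z\in\mathbb C_+}u(z)\le 0\qquad\forall x_0\in\mathbb R$$ and $$\lim_{t\to\infty}t^{-1}\int_0^{\pi}u^+(te^{i\theta})\,d\nu(\theta)=0,$$ then $u(z)\le 0$ for all $z\in\mathbb C_+$.
   Context: For a real-valued function $h$, $h^+=\max\{h,0\}$. The class $\mathcal A[a,b]$: let $\nu$ be a probability measure on a segment $[a,b]\subset\mathbb R$, identified with its distribution function $\nu(t)=\nu([a,t])$. Suppose $\nu(t)$ is strictly increasing and continuous on $[a,b]$, and let $\mu$ be its inverse function (defined on $[0,1]$), extended to the whole real axis by $\mu(t)=a$ for $t<0$ and $\mu(t)=b$ for $t>1$. Then $\nu\in\mathcal A[a,b]$ means that $$\lim_{\delta\to0}\ \sup_{x\in\mathbb R}\int_0^\delta\frac{\mu(x+t)-\mu(x-t)}{t}\,dt=0.$$ *)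

theory Defs
  imports "HOL-Probability.Probability"
begin

definition upper_half_plane :: "complex set" where
  "upper_half_plane = {z. Im z > 0}"

text \<open>
  The mean over the circle \<open>\<bar>w - z\<bar> = r\<close> of an extended real function, as the difference of the
  Lebesgue integrals of its positive and negative parts (\<^const>\<open>e2ennreal\<close> maps negative
  values to 0). For an upper semicontinuous function \<open>u < \<infinity>\<close> the integral of the positive part is
  finite, so the difference is never \<open>\<infinity> - \<infinity>\<close>; its value may be \<open>-\<infinity>\<close>.
\<close>
definition circle_mean :: "(complex \<Rightarrow> ereal) \<Rightarrow> complex \<Rightarrow> real \<Rightarrow> ereal" where
  "circle_mean u z r =
     (enn2ereal (\<integral>\<^sup>+ \<theta> \<in> {0..2 * pi}. e2ennreal (u (z + of_real r * cis \<theta>)) \<partial>lborel)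
      - enn2ereal (\<integral>\<^sup>+ \<theta> \<in> {0..2 * pi}. e2ennreal (- u (z + of_real r * cis \<theta>)) \<partial>lborel))
     / ereal (2 * pi)"

text \<open>
  Subharmonic functions take values in \<open>[-\<infinity>, \<infinity>)\<close>, are upper semicontinuous and satisfy the
  sub-mean value inequality on every closed disc inside the domain. The constant \<open>-\<infinity>\<close> is allowed.
\<close>
definition subharmonic_on :: "complex set \<Rightarrow> (complex \<Rightarrow> ereal) \<Rightarrow> bool" where
  "subharmonic_on S u \<longleftrightarrow>
     open S \<and>
     (\<forall>z\<in>S. u z < \<infinity>) \<and>
     (\<forall>c. open {z \<in> S. u z < c}) \<and>
     (\<forall>z r. 0 < r \<longrightarrow> cball z r \<subseteq> S \<longrightarrow> u z \<le> circle_mean u z r)"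

text \<open>
  A measure on the segment \<open>[a,b]\<close> is represented as a Borel measure on the real line giving full
  mass to \<open>{a..b}\<close>.
\<close>
definition distr_fun :: "real \<Rightarrow> real measure \<Rightarrow> real \<Rightarrow> real" where
  "distr_fun a \<nu> t = measure \<nu> {a..t}"

definition inv_distr_fun :: "real \<Rightarrow> real \<Rightarrow> real measure \<Rightarrow> real \<Rightarrow> real" where
  "inv_distr_fun a b \<nu> s =
     (if s < 0 then a else if s > 1 then b else the_inv_into {a..b} (distr_fun a \<nu>) s)"

text \<open>
  The condition \<open>distr_fun a \<nu> a = 0\<close> says that \<open>a\<close> is not an atom. Continuity on \<open>{a..b}\<close> alone does
  not give this, and it is needed for the inverse function to be defined on all of \<open>[0,1]\<close>.
  The integrand below is nonnegative because the inverse function is nondecreasing; the supremum is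
  taken in \<^typ>\<open>ennreal\<close>, so it is meaningful also where the integrals are infinite or unbounded.
\<close>
definition class_A :: "real \<Rightarrow> real \<Rightarrow> real measure set" where
  "class_A a b = {\<nu>.
     real_distribution \<nu> \<and>
     measure \<nu> {a..b} = 1 \<and>
     strict_mono_on {a..b} (distr_fun a \<nu>) \<and>
     continuous_on {a..b} (distr_fun a \<nu>) \<and>
     distr_fun a \<nu> a = 0 \<and>
     ((\<lambda>\<delta>. SUP x. \<integral>\<^sup>+ t \<in> {0<..<\<delta>}.
         ennreal ((inv_distr_fun a b \<nu> (x + t) - inv_distr_fun a b \<nu> (x - t)) / t) \<partial>lborel)
       \<longlongrightarrow> 0) (at_right 0)}"

end

theory Submission
  imports Defs "HOL-Complex_Analysis.Complex_Analysis" "HOL-Real_Asymp.Real_Asymp"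
begin

text \<open>
  Let \<open>v\<close> be \<open>max u 0\<close> in the upper half-plane and \<open>0\<close> elsewhere. The boundary condition makes \<open>v\<close> upper
  semicontinuous, so \<open>v\<close> is a nonnegative function on the whole plane with the local sub-mean value
  property, and the claim is \<open>v = 0\<close>. The hypothesis controls \<open>v\<close> only through means against \<open>\<nu>\<close>, which
  may be singular with respect to arc length. The idea is to find a domain whose harmonic measure
  projects radially to \<open>\<nu>\<close>.

  Write \<open>N \<theta> = \<nu> [0,\<theta>]\<close> and let \<open>\<mu>\<close> be its inverse. The map
  \<open>g w = w exp (- (1/\<pi>) \<integral>\<^sub>0\<^sup>\<pi> (Ln (1 - e\<^sup>-\<^sup>i\<^sup>\<pi>\<^sup>N w) + Ln (1 - e\<^sup>i\<^sup>\<pi>\<^sup>N w)) d\<theta>)\<close> of the unit disc is symmetric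
  about the real axis and locally injective, and for \<open>0 < t < \<pi>\<close> its argument at \<open>r e\<^sup>i\<^sup>t\<close> tends
  to \<open>\<mu> (t/\<pi>)\<close> as \<open>r\<close> tends to \<open>1\<close> (lemma \<open>sgn_g_limit\<close>). So arc length on the upper half of the unit circle is carried to a
  multiple of \<open>\<nu>\<close> by the boundary argument of \<open>g\<close>. Moreover \<open>ln \<bar>g w / w\<bar>\<close> is a logarithmic potential of
  the distribution of \<open>N\<close>; written as an integral over level sets it is the integral of
  \<open>(\<mu> (x + t) - \<mu> (x - t)) / t\<close>, and class A says that this is bounded (lemmas \<open>log_potential_bound\<close> and
  \<open>norm_g_bounded\<close>). Hence \<open>\<bar>g w\<bar>\<close> lies between constant multiples of \<open>\<bar>w\<bar>\<close>.

  By the maximum principle and the inequality of Harnack, \<open>v (\<rho> g w)\<close> with \<open>\<bar>w\<bar> \<le> r/2\<close> is at most three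
  times the mean of \<open>v (\<rho> g (r e\<^sup>i\<^sup>t))\<close> over \<open>t\<close> (lemma \<open>subharmonic_le_circle_integral\<close>). The modulus
  of \<open>g\<close> on the circle is not constant, but an average over the dilations \<open>\<rho>\<close> in \<open>[R, 2R]\<close> replaces it by
  an integral along rays, in which only the argument of \<open>g\<close> is left. Now \<open>r\<close> tends to \<open>1\<close>, and upper
  semicontinuity gives a bound of \<open>v\<close> on a disc of radius comparable to \<open>R\<close> by \<open>R\<^sup>-\<^sup>1\<close> times the integral
  of the \<open>\<nu>\<close>-means of \<open>v\<close> over radii comparable to \<open>R\<close>. These means are \<open>o(R)\<close>, so \<open>v z = o(\<bar>z\<bar>)\<close>
  (lemma \<open>growth_from_\<nu>_means\<close>), and the Phragmen-Lindelof principle finishes the proof.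
\<close>

section \<open>Upper semicontinuous real functions\<close>

text \<open>The pointwise form of upper semicontinuity is the one that passes easily to compositions and sums.\<close>
definition usc_on :: "'a::metric_space set \<Rightarrow> ('a \<Rightarrow> real) \<Rightarrow> bool" where
  "usc_on S f \<longleftrightarrow> (\<forall>x\<in>S. \<forall>c. f x < c \<longrightarrow> (\<forall>\<^sub>F y in at x within S. f y < c))"

lemma usc_onD_ball:
  assumes "usc_on S f" "x \<in> S" "f x < c"
  obtains d where "d > 0" "\<And>y. y \<in> S \<Longrightarrow> dist y x < d \<Longrightarrow> f y < c"
proof -
  obtain d where "d > 0" "\<And>y. y \<in> S \<Longrightarrow> y \<noteq> x \<Longrightarrow> dist y x < d \<Longrightarrow> f y < c"
    using assms unfolding usc_on_def eventually_at by (metis)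
  then show ?thesis using that[of d] assms(3) by metis
qed

lemma usc_onI_ball:
  assumes "\<And>x c. x \<in> S \<Longrightarrow> f x < c \<Longrightarrow> \<exists>d>0. \<forall>y\<in>S. dist y x < d \<longrightarrow> f y < c"
  shows "usc_on S f"
  unfolding usc_on_def
proof (intro ballI allI impI)
  fix x c assume "x \<in> S" "f x < c"
  then obtain d where "d > 0" "\<forall>y\<in>S. dist y x < d \<longrightarrow> f y < c" using assms by blast
  then show "\<forall>\<^sub>F y in at x within S. f y < c" unfolding eventually_at by blast
qed

text \<open>
  If no point were a maximum, each \<open>x\<close> would have some \<open>m x\<close> with a larger value, and the sets on which
  \<open>f\<close> stays below \<open>f (m x)\<close> would cover \<open>S\<close>. The largest \<open>f (m x)\<close> of a finite subcover bounds \<open>f\<close>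
  strictly, also at the point \<open>m x\<close> itself.
\<close>
lemma usc_attains_max:
  assumes "compact S" "S \<noteq> {}" "usc_on S f"
  obtains x where "x \<in> S" "\<And>y. y \<in> S \<Longrightarrow> f y \<le> f x"
proof (rule ccontr)
  assume neg: "\<not> thesis"
  then have "\<forall>x\<in>S. \<exists>y\<in>S. f x < f y" using that by force
  then obtain m where m: "\<And>x. x \<in> S \<Longrightarrow> m x \<in> S \<and> f x < f (m x)" by metis
  have "\<forall>x\<in>S. \<exists>d>0. \<forall>y\<in>S. dist y x < d \<longrightarrow> f y < f (m x)"
    using m usc_onD_ball[OF assms(3)] by metis
  then obtain d where d: "\<And>x. x \<in> S \<Longrightarrow> d x > 0"
    "\<And>x y. x \<in> S \<Longrightarrow> y \<in> S \<Longrightarrow> dist y x < d x \<Longrightarrow> f y < f (m x)" by metis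
  have "S \<subseteq> (\<Union>x\<in>S. ball x (d x))" using d(1) by force
  from compactE_image[OF assms(1) _ this] obtain T
    where T: "T \<subseteq> S" "finite T" "S \<subseteq> (\<Union>x\<in>T. ball x (d x))" by auto
  have "T \<noteq> {}" using T(3) assms(2) by auto
  then obtain x where x: "x \<in> T" "\<And>y. y \<in> T \<Longrightarrow> f (m y) \<le> f (m x)"
    using Max_in[of "(\<lambda>y. f (m y)) ` T"] Max_ge[of "(\<lambda>y. f (m y)) ` T"] T(2) by fastforce
  have "m x \<in> S" using x T m by auto
  then obtain y where "y \<in> T" "m x \<in> ball y (d y)" using T(3) by auto
  then have "f (m x) < f (m y)" using d(2)[of y "m x"] T(1) \<open>m x \<in> S\<close> by (auto simp: dist_commute)
  then show False using x(2)[OF \<open>y \<in> T\<close>] by simp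
qed

lemma usc_on_compose:
  assumes "usc_on T f" "continuous_on S g" "g ` S \<subseteq> T"
  shows "usc_on S (\<lambda>x. f (g x))"
proof (rule usc_onI_ball)
  fix x c assume x: "x \<in> S" "f (g x) < c"
  then obtain d where d: "d > 0" "\<And>y. y \<in> T \<Longrightarrow> dist y (g x) < d \<Longrightarrow> f y < c"
    using usc_onD_ball[OF assms(1)] assms(3) by (metis image_subset_iff)
  obtain e where "e > 0" "\<And>y. y \<in> S \<Longrightarrow> dist y x < e \<Longrightarrow> dist (g y) (g x) < d"
    using assms(2) x d unfolding continuous_on_iff by metis
  then show "\<exists>d>0. \<forall>y\<in>S. dist y x < d \<longrightarrow> f (g y) < c"
    using d assms(3) by (metis image_subset_iff)
qed

lemma usc_on_add_continuous:
  assumes "usc_on S f" "continuous_on S h"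
  shows "usc_on S (\<lambda>x. f x + h x)"
proof (rule usc_onI_ball)
  fix x c assume x: "x \<in> S" "f x + h x < c"
  define e where "e = (c - (f x + h x)) / 2"
  have "e > 0" using x by (simp add: e_def)
  obtain d where d: "d > 0" "\<And>y. y \<in> S \<Longrightarrow> dist y x < d \<Longrightarrow> f y < f x + e"
    using usc_onD_ball[OF assms(1) x(1), of "f x + e"] \<open>e > 0\<close> by auto
  obtain d' where d': "d' > 0" "\<And>y. y \<in> S \<Longrightarrow> dist y x < d' \<Longrightarrow> dist (h y) (h x) < e"
    using assms(2) x \<open>e > 0\<close> unfolding continuous_on_iff by metis
  show "\<exists>d>0. \<forall>y\<in>S. dist y x < d \<longrightarrow> f y + h y < c"
  proof (intro exI[of _ "min d d'"] conjI ballI impI)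
    fix y assume y: "y \<in> S" "dist y x < min d d'"
    have "f y < f x + e" "\<bar>h y - h x\<bar> < e" using d d' y by (auto simp: dist_real_def)
    then show "f y + h y < c" unfolding e_def by argo
  qed (use d d' in auto)
qed

lemma usc_on_borel_measurable:
  assumes "usc_on UNIV f"
  shows "f \<in> borel_measurable borel"
proof (rule borel_measurableI_less)
  fix c
  have "\<exists>d>0. \<forall>y. dist y x < d \<longrightarrow> f y < c" if "f x < c" for x
    using usc_onD_ball[OF assms UNIV_I that] by (metis UNIV_I)
  then have "open {x. f x < c}" unfolding open_dist by blast
  then show "{x \<in> space borel. f x < c} \<in> sets borel" by simp
qed

lemma usc_on_bounded_above:
  assumes "compact S" "usc_on S f"
  obtains M where "M > 0" "\<And>x. x \<in> S \<Longrightarrow> f x \<le> M"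
proof (cases "S = {}")
  case True then show ?thesis using that[of 1] by auto
next
  case False
  then obtain x where "x \<in> S" "\<And>y. y \<in> S \<Longrightarrow> f y \<le> f x"
    using usc_attains_max[OF assms(1) _ assms(2)] by blast
  then show ?thesis using that[of "max 1 (f x)"] by fastforce
qed

lemma usc_limsup_ennreal:
  assumes f: "usc_on UNIV f" and lim: "(X \<longlongrightarrow> x) sequentially"
  shows "limsup (\<lambda>n::nat. ennreal (f (X n))) \<le> ennreal (f x)"
proof (rule Limsup_le_iff[THEN iffD2], intro allI impI)
  fix y assume y: "ennreal (f x) < y"
  then obtain c' where c': "ennreal (f x) < c'" "c' < y" using dense by blast
  then obtain c where "c' = ennreal c" by (cases c') auto
  then have c: "ennreal (f x) < ennreal c" "ennreal c < y" using c' by auto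
  have "f x < c" using ennreal_leI[of c "f x"] c(1) by (meson leD not_le)
  from usc_onD_ball[OF f UNIV_I this] obtain d
    where d: "d > 0" "\<And>z. dist z x < d \<Longrightarrow> f z < c" by auto
  have "\<forall>\<^sub>F n in sequentially. dist (X n) x < d" using lim d(1) by (rule tendstoD)
  then show "\<forall>\<^sub>F n in sequentially. ennreal (f (X n)) < y"
  proof eventually_elim
    case (elim n)
    then have "ennreal (f (X n)) \<le> ennreal c" using d(2) by (intro ennreal_leI) force
    then show ?case using c by simp
  qed
qed

text \<open>
  The approximants are the sup-convolutions \<open>h n x = sup\<^sub>y (f y - n dist x y)\<close>, which are \<open>n\<close>-Lipschitz
  and decrease to \<open>f\<close>. They make Dirichlet problems with upper semicontinuous data accessible through
  continuous data.
\<close>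
lemma usc_continuous_approx:
  fixes f :: "'a::metric_space \<Rightarrow> real"
  assumes S: "compact S" and f: "usc_on S f" and pos: "\<And>x. x \<in> S \<Longrightarrow> 0 \<le> f x"
  obtains h :: "nat \<Rightarrow> 'a \<Rightarrow> real" and M where
    "\<And>n. continuous_on S (h n)" "\<And>n x. x \<in> S \<Longrightarrow> f x \<le> h n x" "\<And>n x. x \<in> S \<Longrightarrow> h n x \<le> M"
    "\<And>x. x \<in> S \<Longrightarrow> (\<lambda>n. h n x) \<longlonglongrightarrow> f x"
proof -
  obtain M where M: "M > 0" "\<And>x. x \<in> S \<Longrightarrow> f x \<le> M" using usc_on_bounded_above[OF S f] by metis
  define h where "h = (\<lambda>(n::nat) x. SUP y\<in>S. f y - real n * dist x y)"
  have le_M: "f y - real n * dist x y \<le> M" if "y \<in> S" for x y n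
    using M(2)[OF that] by (smt (verit) mult_nonneg_nonneg of_nat_0_le_iff zero_le_dist)
  have bdd: "bdd_above ((\<lambda>y. f y - real n * dist x y) ` S)" for n x
    using le_M by (intro bdd_aboveI[of _ M]) auto
  have up: "f y - real n * dist x y \<le> h n x" if "y \<in> S" for x y n
    unfolding h_def by (rule cSUP_upper[OF that bdd])
  have h_le: "h n x \<le> B" if "x \<in> S" "\<And>y. y \<in> S \<Longrightarrow> f y - real n * dist x y \<le> B" for n x B
    unfolding h_def using that by (intro cSUP_least) auto
  have lip: "h n x \<le> h n x' + real n * dist x x'" if "x \<in> S" "x' \<in> S" for n x x'
  proof (rule h_le[OF that(1)])
    fix y assume y: "y \<in> S"
    have "real n * dist x' y \<le> real n * (dist x x' + dist x y)"
      by (intro mult_left_mono) (metis dist_commute dist_triangle, simp)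
    then show "f y - real n * dist x y \<le> h n x' + real n * dist x x'"
      using up[OF y, of n x'] by (simp add: algebra_simps)
  qed
  have cont: "continuous_on S (h n)" for n
  proof (rule continuous_onI)
    fix x e assume x: "x \<in> S" "(e::real) > 0"
    show "\<exists>d>0. \<forall>x'\<in>S. dist x' x < d \<longrightarrow> dist (h n x') (h n x) \<le> e"
    proof (intro exI[of _ "e / (real n + 1)"] conjI ballI impI)
      fix x' assume x': "x' \<in> S" "dist x' x < e / (real n + 1)"
      then have "(real n + 1) * dist x' x < e" by (simp add: pos_less_divide_eq mult.commute)
      then have "real n * dist x' x \<le> e" by (smt (verit) mult_right_mono zero_le_dist)
      then show "dist (h n x') (h n x) \<le> e"
        using lip[OF x(1) x'(1), of n] lip[OF x'(1) x(1), of n]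
        by (auto simp: dist_real_def dist_commute)
    qed (use x in auto)
  qed
  have ge: "f x \<le> h n x" if "x \<in> S" for n x using up[OF that, of n x] by simp
  have conv: "(\<lambda>n. h n x) \<longlonglongrightarrow> f x" if x: "x \<in> S" for x
  proof (rule order_tendstoI)
    fix c assume "c < f x" then show "\<forall>\<^sub>F n in sequentially. c < h n x"
      using ge[OF x] by (intro always_eventually allI) (metis less_le_trans)
  next
    fix c assume c: "f x < c"
    define c' where "c' = (f x + c) / 2"
    have c': "f x < c'" "c' < c" using c by (auto simp: c'_def)
    obtain d where d: "d > 0" "\<And>y. y \<in> S \<Longrightarrow> dist y x < d \<Longrightarrow> f y < c'"
      using usc_onD_ball[OF f x c'(1)] by metis
    have "\<forall>\<^sub>F n in sequentially. real n \<ge> M / d" 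
      by (metis (mono_tags, lifting) eventually_sequentiallyI of_nat_mono order_trans real_arch_simple)
    then show "\<forall>\<^sub>F n in sequentially. h n x < c"
    proof eventually_elim
      case (elim n)
      have "h n x \<le> c'"
      proof (rule h_le[OF x])
        fix y assume y: "y \<in> S"
        show "f y - real n * dist x y \<le> c'"
        proof (cases "dist y x < d")
          case True
          then show ?thesis using d(2)[OF y] by (smt (verit) mult_nonneg_nonneg of_nat_0_le_iff zero_le_dist)
        next
          case False
          then have "(M / d) * d \<le> real n * dist x y" using elim d M
            by (intro mult_mono) (auto simp: dist_commute)
          then show ?thesis using M(2)[OF y] d(1) c' pos[OF x] by simp
        qed
      qed
      then show ?case using c' by simp
    qed
  qed
  show ?thesis by (rule that[of h M, OF cont ge _ conv]) (auto intro: h_le le_M)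
qed

section \<open>Mean values of holomorphic functions\<close>

lemma holomorphic_mean_value:
  assumes "f holomorphic_on cball z r" "r > 0"
  shows "((\<lambda>\<theta>. Re (f (z + of_real r * cis \<theta>))) has_integral 2 * pi * Re (f z)) {0..2 * pi}"
proof -
  have "((\<lambda>u. f u / (u - z)) has_contour_integral (2 * of_real pi * \<i> * f z)) (circlepath z r)"
    using Cauchy_integral_circlepath_simple[OF assms(1), of z] assms(2) by simp
  then have "((\<lambda>t. f (z + r * cis t) / (z + r * cis t - z) * r * \<i> * cis t)
      has_integral (2 * of_real pi * \<i> * f z)) {0..2 * pi}"
    unfolding circlepath_def by (subst (asm) has_contour_integral_part_circlepath_iff) auto
  then have "((\<lambda>t. \<i> * f (z + r * cis t)) has_integral (2 * of_real pi * \<i> * f z)) {0..2 * pi}"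
    using assms(2) by (simp add: field_simps)
  from has_integral_mult_right[OF this, of "-\<i>"]
  have "((\<lambda>t. f (z + r * cis t)) has_integral (2 * of_real pi * f z)) {0..2 * pi}"
    by (simp add: algebra_simps)
  from has_integral_linear[OF this bounded_linear_Re]
  show ?thesis by (simp add: o_def)
qed

lemma set_nn_integral_has_integral:
  fixes f :: "'a::euclidean_space \<Rightarrow> real"
  assumes "\<And>x. x \<in> S \<Longrightarrow> 0 \<le> f x" "(f has_integral I) S"
  shows "(\<integral>\<^sup>+x\<in>S. ennreal (f x) \<partial>lborel) = ennreal I"
proof -
  have "(\<integral>\<^sup>+x\<in>S. ennreal (f x) \<partial>lborel) = integral\<^sup>N lborel (\<lambda>x. ennreal (indicator S x * f x))"
    by (intro nn_integral_cong) (auto split: split_indicator)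
  then show ?thesis using nn_integral_has_integral_lebesgue[OF assms] by simp
qed

text \<open>
  The constant \<open>c\<close> is kept apart from the holomorphic function because the comparison below is with the
  real part of a holomorphic function shifted by a real number.
\<close>
lemma nn_integral_circle_Re:
  assumes "f holomorphic_on cball z r" "r > 0"
    and "\<And>\<theta>. \<theta> \<in> {0..2 * pi} \<Longrightarrow> 0 \<le> Re (f (z + of_real r * cis \<theta>)) + c"
  shows "(\<integral>\<^sup>+\<theta>\<in>{0..2 * pi}. ennreal (Re (f (z + of_real r * cis \<theta>)) + c) \<partial>lborel)
      = ennreal (2 * pi * (Re (f z) + c))" (is ?eq)
    and "0 \<le> Re (f z) + c"
proof -
  have I: "((\<lambda>\<theta>. Re (f (z + of_real r * cis \<theta>)) + c) has_integral 2 * pi * (Re (f z) + c)) {0..2 * pi}"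
    using has_integral_add[OF holomorphic_mean_value[OF assms(1,2)] has_integral_const_real[of c 0 "2 * pi"]]
    by (simp add: distrib_left)
  show ?eq
    using assms(3) I by (intro set_nn_integral_has_integral) auto
  have "0 \<le> 2 * pi * (Re (f z) + c)"
    using has_integral_nonneg[OF I] assms(3) by auto
  then show "0 \<le> Re (f z) + c" using pi_gt_zero by (simp add: zero_le_mult_iff)
qed

section \<open>A maximum principle through conformal maps\<close>

text \<open>
  Subharmonicity on the whole plane in its weakest useful form: the sub-mean value inequality is only
  required for small radii. This local form is immediate for an extension by zero at the points of the
  real axis, where the function vanishes.
\<close>
definition nn_subharmonic :: "(complex \<Rightarrow> real) \<Rightarrow> bool" where
  "nn_subharmonic v \<longleftrightarrow>
     (\<forall>z. 0 \<le> v z) \<and> usc_on UNIV v \<and>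
     (\<forall>z. \<exists>\<rho>>0. \<forall>r. 0 < r \<and> r < \<rho> \<longrightarrow>
        ennreal (2 * pi * v z) \<le> (\<integral>\<^sup>+\<theta>\<in>{0..2 * pi}. ennreal (v (z + of_real r * cis \<theta>)) \<partial>lborel))"

text \<open>
  A function \<open>v + \<epsilon> \<bar>z\<bar>\<^sup>2 - Re Q\<close> with \<open>Q\<close> holomorphic has no local maximum: the square modulus raises the
  mean over a circle of radius \<open>s\<close> by \<open>\<epsilon> s\<^sup>2\<close>. The strictness avoids any connectedness argument in the
  maximum principle.
\<close>
lemma subharmonic_strict_majorant:
  assumes v: "nn_subharmonic v" and U: "open U" "z0 \<in> U" and Q: "Q holomorphic_on U" and \<epsilon>: "\<epsilon> > 0"
    and le: "\<And>z. z \<in> U \<Longrightarrow> v z + \<epsilon> * (cmod z)\<^sup>2 - Re (Q z) \<le> C"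
    and eq: "v z0 + \<epsilon> * (cmod z0)\<^sup>2 - Re (Q z0) = C"
  shows False
proof -
  obtain \<rho> where \<rho>: "\<rho> > 0" "\<And>r. 0 < r \<Longrightarrow> r < \<rho> \<Longrightarrow>
      ennreal (2 * pi * v z0) \<le> (\<integral>\<^sup>+\<theta>\<in>{0..2 * pi}. ennreal (v (z0 + of_real r * cis \<theta>)) \<partial>lborel)"
    using v unfolding nn_subharmonic_def by meson
  obtain e where e: "e > 0" "cball z0 e \<subseteq> U" using U open_contains_cball by metis
  define s where "s = min e (\<rho> / 2)"
  have s: "s > 0" "s < \<rho>" "cball z0 s \<subseteq> U" using \<rho> e by (auto simp: s_def)
  (* On the circle \<bar>z - z0\<bar> = s the function \<epsilon> \<bar>z\<bar>^2 agrees with the real part of a holomorphic function up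
     to a constant, by \<bar>z\<bar>^2 = 2 Re (cnj z0 * z) - \<bar>z0\<bar>^2 + s^2. *)
  define G where "G = (\<lambda>z. Q z - of_real (2 * \<epsilon>) * cnj z0 * z)"
  define c where "c = C + \<epsilon> * (cmod z0)\<^sup>2 - \<epsilon> * s\<^sup>2"
  have G: "G holomorphic_on cball z0 s"
    unfolding G_def by (intro holomorphic_intros holomorphic_on_subset[OF Q] s)
  have vle: "v (z0 + of_real s * cis \<theta>) \<le> Re (G (z0 + of_real s * cis \<theta>)) + c" for \<theta>
  proof -
    define z where "z = z0 + of_real s * cis \<theta>"
    have "cmod (z - z0) = s" using s by (simp add: z_def norm_mult)
    moreover have "(cmod z)\<^sup>2 = 2 * Re (cnj z0 * z) - (cmod z0)\<^sup>2 + (cmod (z - z0))\<^sup>2"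
      unfolding cmod_power2 by (simp add: power2_eq_square algebra_simps)
    moreover have "z \<in> U" using s by (auto simp: z_def norm_mult dist_norm)
    moreover have "Re (G z) = Re (Q z) - 2 * \<epsilon> * Re (cnj z0 * z)" by (simp add: G_def algebra_simps)
    moreover have "\<epsilon> * (2 * Re (cnj z0 * z) - (cmod z0)\<^sup>2 + s\<^sup>2) =
        2 * \<epsilon> * Re (cnj z0 * z) - \<epsilon> * (cmod z0)\<^sup>2 + \<epsilon> * s\<^sup>2" by (simp add: algebra_simps)
    ultimately have "v z \<le> Re (G z) + c" using le[of z] unfolding c_def by simp
    then show ?thesis by (simp add: z_def)
  qed
  have v0: "0 \<le> v z" for z using v by (simp add: nn_subharmonic_def)
  have nn: "0 \<le> Re (G (z0 + of_real s * cis \<theta>)) + c" for \<theta> using vle[of \<theta>] v0[of "z0 + of_real s * cis \<theta>"] by simp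
  have "ennreal (2 * pi * v z0) \<le> (\<integral>\<^sup>+\<theta>\<in>{0..2 * pi}. ennreal (v (z0 + of_real s * cis \<theta>)) \<partial>lborel)"
    using \<rho> s by blast
  also have "\<dots> \<le> (\<integral>\<^sup>+\<theta>\<in>{0..2 * pi}. ennreal (Re (G (z0 + of_real s * cis \<theta>)) + c) \<partial>lborel)"
    by (intro nn_integral_mono mult_right_mono ennreal_leI vle) auto
  also have "\<dots> = ennreal (2 * pi * (Re (G z0) + c))"
    by (rule nn_integral_circle_Re(1)[OF G s(1) nn])
  finally have "2 * pi * v z0 \<le> 2 * pi * (Re (G z0) + c)"
    using nn_integral_circle_Re(2)[OF G s(1) nn] by (subst (asm) ennreal_le_iff) auto
  then have "v z0 \<le> Re (G z0) + c" by simp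
  also have "Re (G z0) + c = v z0 - \<epsilon> * s\<^sup>2"
  proof -
    have "Re (of_real (2 * \<epsilon>) * cnj z0 * z0) = 2 * \<epsilon> * (cmod z0)\<^sup>2"
      unfolding cmod_power2 by (simp add: power2_eq_square algebra_simps)
    then show ?thesis using eq by (simp add: G_def c_def)
  qed
  finally show False using s \<epsilon> by (simp add: mult_le_0_iff)
qed

text \<open>
  The maximum principle for \<open>v \<circ> g - Re P\<close>. At an interior
  maximum of \<open>v \<circ> g + \<epsilon> \<bar>g\<bar>\<^sup>2 - Re P\<close> the map \<open>g\<close> has a local holomorphic inverse \<open>k\<close>, so the situation can
  be read off in the target plane, where \<open>Re (P \<circ> k)\<close> is harmonic and \<open>v\<close> satisfies its sub-mean value
  inequality.
\<close>
lemma subharmonic_compose_le_Re: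
  assumes v: "nn_subharmonic v" and K: "compact K" "K \<subseteq> U" and U: "open U"
    and g: "g holomorphic_on U" and P: "P holomorphic_on U"
    and bd: "\<And>w. w \<in> K \<Longrightarrow> w \<in> interior K \<and> deriv g w \<noteq> 0 \<or> v (g w) \<le> Re (P w)"
    and w: "w \<in> K"
  shows "v (g w) \<le> Re (P w)"
proof -
  have gc: "continuous_on K g" and Pc: "continuous_on K P"
    using g P K by (auto intro: holomorphic_on_imp_continuous_on holomorphic_on_subset)
  have "compact ((\<lambda>w. (cmod (g w))\<^sup>2) ` K)"
    by (intro compact_continuous_image continuous_intros gc K)
  then have "bdd_above ((\<lambda>w. (cmod (g w))\<^sup>2) ` K)" by (intro bounded_imp_bdd_above compact_imp_bounded)
  then obtain M where M: "\<And>w. w \<in> K \<Longrightarrow> (cmod (g w))\<^sup>2 \<le> M" by (auto simp: bdd_above_def)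
  have M0: "M \<ge> 0" using M[OF w] by (meson order_trans zero_le_power2)
  have usc: "usc_on UNIV v" and v0: "\<And>z. 0 \<le> v z" using v by (auto simp: nn_subharmonic_def)
  have main: "v (g w) - Re (P w) \<le> \<epsilon> * M" if \<epsilon>: "\<epsilon> > 0" for \<epsilon>
  proof -
    define F where "F = (\<lambda>w. v (g w) + (\<epsilon> * (cmod (g w))\<^sup>2 - Re (P w)))"
    have "usc_on K F" unfolding F_def
      by (intro usc_on_add_continuous usc_on_compose[OF usc gc] continuous_intros gc Pc) auto
    then obtain m where m: "m \<in> K" "\<And>y. y \<in> K \<Longrightarrow> F y \<le> F m"
      using usc_attains_max[OF K(1)] w by (metis empty_iff)
    show ?thesis
    proof (cases "v (g m) \<le> Re (P m)")
      case True
      have "v (g w) - Re (P w) \<le> F w" using \<epsilon> by (simp add: F_def)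
      also have "\<dots> \<le> F m" using m w by blast
      also have "\<dots> \<le> \<epsilon> * (cmod (g m))\<^sup>2" using True by (simp add: F_def)
      also have "\<dots> \<le> \<epsilon> * M" using M m \<epsilon> by (intro mult_left_mono) auto
      finally show ?thesis .
    next
      case False
      then have mi: "m \<in> interior K" "deriv g m \<noteq> 0" using bd m by auto
      have gi: "g holomorphic_on interior K"
        using g K by (meson holomorphic_on_subset interior_subset order_trans)
      obtain r where r: "r > 0" "ball m r \<subseteq> interior K" "inj_on g (ball m r)"
        using has_complex_derivative_locally_injective[OF gi mi(1) open_interior mi(2)] by metis
      have gb: "g holomorphic_on ball m r" using gi r holomorphic_on_subset by blast
      obtain k where k: "k holomorphic_on g ` ball m r" "\<And>z. z \<in> ball m r \<Longrightarrow> k (g z) = z"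
        using holomorphic_has_inverse[OF gb open_ball r(3)] by metis
      have op: "open (g ` ball m r)" by (rule open_mapping_thm3[OF gb open_ball r(3)])
      have kim: "k ` (g ` ball m r) \<subseteq> U" using k(2) r(2) K(2) interior_subset by fastforce
      have Pk: "(P \<circ> k) holomorphic_on g ` ball m r"
        by (rule holomorphic_on_compose_gen[OF k(1) P kim])
      have False
      proof (rule subharmonic_strict_majorant[OF v op _ Pk \<epsilon>, of "g m" "F m"])
        show "g m \<in> g ` ball m r" using r by auto
        show "v (g m) + \<epsilon> * (cmod (g m))\<^sup>2 - Re ((P \<circ> k) (g m)) = F m"
          using k(2)[of m] r by (simp add: F_def)
      next
        fix z assume "z \<in> g ` ball m r"
        then obtain y where y: "y \<in> ball m r" "z = g y" by auto
        then have "y \<in> K" using r(2) interior_subset by blast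
        then show "v z + \<epsilon> * (cmod z)\<^sup>2 - Re ((P \<circ> k) z) \<le> F m"
          using m(2)[of y] k(2)[OF y(1)] y(2) by (simp add: F_def)
      qed
      then show ?thesis ..
    qed
  qed
  have "v (g w) - Re (P w) \<le> 0 + e" if "e > 0" for e
  proof -
    have "v (g w) - Re (P w) \<le> e / (M + 1) * M" using M0 that by (intro main) auto
    also have "\<dots> \<le> e" using M0 that by (simp add: field_simps)
    finally show ?thesis by simp
  qed
  then have "v (g w) - Re (P w) \<le> 0" by (rule field_le_epsilon)
  then show ?thesis by simp
qed

section \<open>A Phragmen-Lindelof principle for the half-plane\<close>

text \<open>
  On the half-disc of radius \<open>R\<close> the harmonic polynomial \<open>(x\<^sup>2 - y\<^sup>2) / R + 2 y\<close> is nonnegative on the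
  diameter and at least \<open>R\<close> on the arc, corners included, so \<open>\<epsilon>\<close> times it dominates \<open>v\<close>. For fixed \<open>z\<close>
  and large \<open>R\<close> its value is at most \<open>2 Im z + 1\<close>, and then \<open>\<epsilon>\<close> tends to \<open>0\<close>.
\<close>
lemma phragmen_lindelof_half_plane:
  assumes v: "nn_subharmonic v" and low: "\<And>z. Im z \<le> 0 \<Longrightarrow> v z = 0"
    and growth: "\<And>\<epsilon>. \<epsilon> > 0 \<Longrightarrow> \<exists>\<rho>. \<forall>z. cmod z \<ge> \<rho> \<longrightarrow> v z \<le> \<epsilon> * cmod z"
  shows "v z = 0"
proof (cases "Im z \<le> 0")
  case True then show ?thesis by (rule low)
next
  case False
  have "v z \<le> \<epsilon> * (2 * Im z + 1)" if \<epsilon>: "\<epsilon> > 0" for \<epsilon>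
  proof -
    obtain \<rho> where \<rho>: "\<And>z. cmod z \<ge> \<rho> \<Longrightarrow> v z \<le> \<epsilon> * cmod z" using growth[OF \<epsilon>] by auto
    define R where "R = max \<rho> (cmod z) + (Re z)\<^sup>2 + 1"
    have R: "R \<ge> \<rho>" "R \<ge> cmod z" "R \<ge> (Re z)\<^sup>2" "R > 0"
      unfolding R_def by (auto simp: max_def) (smt (verit) norm_ge_zero zero_le_power2)+
    define K where "K = {z. cmod z \<le> R \<and> Im z \<ge> 0}"
    define P where "P = (\<lambda>z. of_real \<epsilon> * (z\<^sup>2 / of_real R - 2 * \<i> * z))"
    have ReP: "Re (P z) = \<epsilon> * (((Re z)\<^sup>2 - (Im z)\<^sup>2) / R + 2 * Im z)" for z
      unfolding P_def by (simp add: power2_eq_square Re_divide)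
    have Keq: "K = cball 0 R \<inter> {z. 0 \<le> Im z}" by (auto simp: K_def)
    have "compact K" unfolding Keq by (intro compact_Int_closed closed_halfspace_Im_ge) auto
    have "v (id z) \<le> Re (P z)"
    proof (rule subharmonic_compose_le_Re[OF v \<open>compact K\<close> subset_UNIV open_UNIV, where g = id and P = P])
      show "P holomorphic_on UNIV" using R(4) unfolding P_def by (intro holomorphic_intros) auto
      show "z \<in> K" using R False by (auto simp: K_def)
      fix y assume y: "y \<in> K"
      consider "Im y = 0" | "cmod y = R" | "Im y > 0" "cmod y < R" using y by (force simp: K_def)
      then show "y \<in> interior K \<and> deriv id y \<noteq> 0 \<or> v (id y) \<le> Re (P y)"
      proof cases
        case 1
        then show ?thesis using low[of y] \<epsilon> R by (simp add: ReP)
      next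
        case 2
        have "R\<^sup>2 = (Re y)\<^sup>2 + (Im y)\<^sup>2" using 2 by (simp add: cmod_power2 flip: 2)
        moreover have "Im y \<le> R" using 2 abs_Im_le_cmod[of y] by simp
        then have "Im y * Im y \<le> Im y * R" using y by (intro mult_left_mono) (auto simp: K_def)
        ultimately have "R * R \<le> (Re y)\<^sup>2 - (Im y)\<^sup>2 + 2 * Im y * R"
          by (simp add: power2_eq_square)
        then have "R \<le> ((Re y)\<^sup>2 - (Im y)\<^sup>2) / R + 2 * Im y" using R(4) by (simp add: field_simps)
        then have "\<epsilon> * R \<le> Re (P y)" using \<epsilon> by (simp add: ReP)
        then show ?thesis using \<rho>[of y] 2 R by simp
      next
        case 3
        have "open (ball 0 R \<inter> {z. 0 < Im z})" by (intro open_Int open_halfspace_Im_gt) auto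
        moreover have "ball 0 R \<inter> {z. 0 < Im z} \<subseteq> K" by (auto simp: K_def)
        ultimately have "y \<in> interior K" using 3 by (intro interiorI) auto
        then show ?thesis by simp
      qed
    qed auto
    also have "Re (P z) \<le> \<epsilon> * (2 * Im z + 1)"
    proof -
      have "((Re z)\<^sup>2 - (Im z)\<^sup>2) / R \<le> 1" using R by (simp add: field_simps) (smt (verit) zero_le_power2)
      then show ?thesis using \<epsilon> by (simp add: ReP)
    qed
    finally show ?thesis by simp
  qed note * = this
  have "v z \<le> 0 + e" if "e > 0" for e
    using *[of "e / (2 * Im z + 1)"] False that by simp
  then have "v z \<le> 0" by (rule field_le_epsilon)
  then show ?thesis using v by (simp add: nn_subharmonic_def order_antisym)
qed

section \<open>Subharmonic functions and circle integrals of conformal images\<close>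

lemma Re_mult_Re: "Re x * Re y = (Re (x * y) + Re (x * cnj y)) / 2"
proof -
  have "Re (x * y) + Re (x * cnj y) = 2 * (Re x * Re y)" by simp
  then show ?thesis by simp
qed

text \<open>
  Real parts of polynomials solve the Dirichlet problem up to \<open>e\<close> on the unit circle. On the circle they
  form an algebra: a product of real parts of monomials involves \<open>z\<^sup>m cnj z\<^sup>n\<close>, which is \<open>z\<^sup>m\<^sup>-\<^sup>n\<close> for
  \<open>n \<le> m\<close>. So the theorem of Stone and Weierstrass applies.
\<close>
lemma Re_poly_dense_unit_circle:
  fixes h :: "complex \<Rightarrow> real"
  assumes h: "continuous_on (sphere 0 1) h" and e: "e > 0"
  obtains p where "\<And>z. cmod z = 1 \<Longrightarrow> \<bar>h z - Re (poly p z)\<bar> < e"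
proof -
  define R :: "(complex \<Rightarrow> real) set" where "R = {f. \<exists>p. \<forall>z. cmod z = 1 \<longrightarrow> f z = Re (poly p z)}"
  have RI: "f \<in> R" if "\<And>z. cmod z = 1 \<Longrightarrow> f z = Re (poly p z)" for f p
    using that by (auto simp: R_def)
  have add: "(\<lambda>z. f z + g z) \<in> R" if fg: "f \<in> R" "g \<in> R" for f g
  proof -
    obtain p q where "\<forall>z. cmod z = 1 \<longrightarrow> f z = Re (poly p z)" "\<forall>z. cmod z = 1 \<longrightarrow> g z = Re (poly q z)"
      using fg by (auto simp: R_def)
    then show ?thesis by (intro RI[of _ "p + q"]) auto
  qed
  have sum: "(\<lambda>z. \<Sum>i\<in>I. f i z) \<in> R" if "finite I" "\<And>i. i \<in> I \<Longrightarrow> f i \<in> R" for I :: "nat set" and f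
    using that by (induction I) (auto intro: add RI[of _ 0])
  have mono1: "(\<lambda>z. Re (a * z ^ m) * Re (b * z ^ n)) \<in> R" if "n \<le> m" for a b m n
  proof (rule RI[of _ "monom (a * b / 2) (m + n) + monom (a * cnj b / 2) (m - n)"])
    fix z :: complex assume z: "cmod z = 1"
    have "z * cnj z = 1" using z complex_norm_square[of z] by simp
    then have "z ^ n * cnj z ^ n = 1" by (metis power_mult_distrib power_one)
    then have "z ^ m * cnj z ^ n = z ^ (m - n)"
      using power_add[of z "m - n" n] that by (simp add: mult.assoc)
    then have 1: "(a * z ^ m) * cnj (b * z ^ n) = a * cnj b * z ^ (m - n)"
      by (simp add: mult.assoc mult.left_commute)
    have 2: "(a * z ^ m) * (b * z ^ n) = a * b * z ^ (m + n)" by (simp add: power_add)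
    have 3: "poly (monom (a * b / 2) (m + n) + monom (a * cnj b / 2) (m - n)) z =
        (a * b * z ^ (m + n) + a * cnj b * z ^ (m - n)) / 2"
      by (simp add: poly_monom add_divide_distrib)
    show "Re (a * z ^ m) * Re (b * z ^ n) =
       Re (poly (monom (a * b / 2) (m + n) + monom (a * cnj b / 2) (m - n)) z)"
      unfolding Re_mult_Re[of "a * z ^ m"] 1 2 3 Re_divide_numeral by simp
  qed
  have mono: "(\<lambda>z. Re (a * z ^ m) * Re (b * z ^ n)) \<in> R" for a b m n
    using mono1[of n m a b] mono1[of m n b a] by (cases "n \<le> m") (auto simp: mult.commute)
  have mult: "(\<lambda>z. f z * g z) \<in> R" if fg: "f \<in> R" "g \<in> R" for f g
  proof -
    obtain p q where p: "\<And>z. cmod z = 1 \<Longrightarrow> f z = Re (poly p z)" and q: "\<And>z. cmod z = 1 \<Longrightarrow> g z = Re (poly q z)"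
      using fg by (auto simp: R_def)
    have "(\<lambda>z. \<Sum>i\<le>degree p. \<Sum>j\<le>degree q. Re (coeff p i * z ^ i) * Re (coeff q j * z ^ j)) \<in> R"
      by (intro sum mono) auto
    then obtain s where s: "\<And>z. cmod z = 1 \<Longrightarrow>
        (\<Sum>i\<le>degree p. \<Sum>j\<le>degree q. Re (coeff p i * z ^ i) * Re (coeff q j * z ^ j)) = Re (poly s z)"
      by (auto simp: R_def)
    show ?thesis
    proof (rule RI[of _ s])
      fix z :: complex assume z: "cmod z = 1"
      have "f z * g z = (\<Sum>i\<le>degree p. \<Sum>j\<le>degree q. Re (coeff p i * z ^ i) * Re (coeff q j * z ^ j))"
        by (simp only: p[OF z] q[OF z] poly_altdef Re_sum sum_product)
      then show "f z * g z = Re (poly s z)" using s[OF z] by simp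
    qed
  qed
  interpret function_ring_on R "sphere (0::complex) 1"
  proof
    show "continuous_on (sphere 0 1) f" if "f \<in> R" for f
    proof -
      have "\<exists>p. \<forall>z. cmod z = 1 \<longrightarrow> f z = Re (poly p z)" using that by (simp add: R_def)
      then obtain p where p: "\<And>z. cmod z = 1 \<Longrightarrow> f z = Re (poly p z)" by blast
      have "continuous_on (sphere 0 1) (\<lambda>z. Re (poly p z))" by (intro continuous_intros)
      then show ?thesis by (rule continuous_on_eq) (auto simp: p)
    qed
    show "(\<lambda>_. c) \<in> R" for c by (rule RI[of _ "[:of_real c:]"]) auto
    show "\<exists>f\<in>R. f x \<noteq> f y" if "x \<noteq> y" for x y
    proof (cases "Re x = Re y")
      case True
      then have "Im x \<noteq> Im y" using that by (simp add: complex_eq_iff)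
      then show ?thesis by (intro bexI[of _ Im] RI[of _ "[:0, -\<i>:]"]) auto
    next
      case False
      then show ?thesis by (intro bexI[of _ Re] RI[of _ "[:0, 1:]"]) auto
    qed
  qed (auto intro: add mult)
  obtain g where g: "g \<in> R" "\<And>x. x \<in> sphere 0 1 \<Longrightarrow> \<bar>h x - g x\<bar> < e"
    using Stone_Weierstrass_basic[OF h e] by auto
  then obtain p where "\<forall>z. cmod z = 1 \<longrightarrow> g z = Re (poly p z)" unfolding R_def by blast
  with g(2) show ?thesis by (intro that[of p]) auto
qed

text \<open>
  The Cayley transform of the target half-plane that sends \<open>F 0\<close> to \<open>0\<close> turns \<open>F\<close> into a self-map of the
  disc, and the lemma of Schwarz bounds it by \<open>1/2\<close> on the disc of radius \<open>1/2\<close>; solving for the real part gives the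
  constant \<open>(1 + 1/2) / (1 - 1/2) = 3\<close>.
\<close>
lemma harnack_half_radius:
  assumes F: "F holomorphic_on ball 0 1" and pos: "\<And>w. cmod w < 1 \<Longrightarrow> 0 < Re (F w)" and w: "cmod w \<le> 1/2"
  shows "Re (F w) \<le> 3 * Re (F 0)"
proof -
  define a where "a = F 0"
  define m where "m = (\<lambda>w. (F w - a) / (F w + cnj a))"
  have a: "Re a > 0" using pos[of 0] by (simp add: a_def)
  have nz: "F w + cnj a \<noteq> 0" if "cmod w < 1" for w
    using pos[OF that] a by (auto simp: complex_eq_iff)
  have lt: "cmod (F w - a) < cmod (F w + cnj a)" if "cmod w < 1" for w
  proof -
    have "0 < Re (F w) * Re a" using pos[OF that] a by simp
    then have "(cmod (F w - a))\<^sup>2 < (cmod (F w + cnj a))\<^sup>2"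
      unfolding cmod_power2 by (simp add: power2_eq_square algebra_simps)
    then show ?thesis by (rule power2_less_imp_less) simp
  qed
  have "cmod (m w) \<le> cmod w"
  proof (rule Schwarz_Lemma(1))
    show "m holomorphic_on ball 0 1" unfolding m_def using nz by (intro holomorphic_intros F) auto
    show "m 0 = 0" by (simp add: m_def a_def)
    show "cmod (m z) < 1" if "cmod z < 1" for z
      using lt[OF that] nz[OF that] by (simp add: m_def norm_divide)
  qed (use w in simp)
  moreover have "cmod (F w - a) = cmod (m w) * cmod (F w + cnj a)"
    using w nz[of w] by (simp add: m_def norm_divide)
  ultimately have "cmod (F w - a) \<le> (1/2) * cmod (F w + cnj a)"
    using w mult_right_mono[of "cmod (m w)" "1/2" "cmod (F w + cnj a)"] by simp
  then have "(cmod (F w - a))\<^sup>2 \<le> ((1/2) * cmod (F w + cnj a))\<^sup>2" by (intro power_mono) auto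
  then have "4 * ((Re (F w) - Re a)\<^sup>2 + (Im (F w) - Im a)\<^sup>2) \<le> (Re (F w) + Re a)\<^sup>2 + (Im (F w) - Im a)\<^sup>2"
    unfolding power_mult_distrib cmod_power2 by (simp add: power2_eq_square[of "1/2"])
  moreover have "0 \<le> (Im (F w) - Im a)\<^sup>2" by simp
  moreover have "4 * A \<le> C" if "4 * (A + D) \<le> C + D" "0 \<le> D" for A C D :: real
    using that by (simp add: distrib_left)
  ultimately have "4 * (Re (F w) - Re a)\<^sup>2 \<le> (Re (F w) + Re a)\<^sup>2" by blast
  then have "(2 * (Re (F w) - Re a))\<^sup>2 \<le> (Re (F w) + Re a)\<^sup>2"
    using power_mult_distrib[of 2 "Re (F w) - Re a" 2] by simp
  then have "2 * (Re (F w) - Re a) \<le> Re (F w) + Re a"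
  proof (rule power2_le_imp_le)
    show "0 \<le> Re (F w) + Re a" using a pos[of w] w by simp
  qed
  then show ?thesis by (simp add: a_def)
qed

text \<open>
  A continuous majorant of \<open>v \<circ> g\<close> on the unit circle is approximated by the real part of a polynomial,
  which dominates \<open>v \<circ> g\<close> in the disc by the maximum principle and is compared with its value at the
  centre, that is, with its mean, by the inequality of Harnack. The majorants then decrease to \<open>v \<circ> g\<close>.
  Comparing with the centre value alone would be useless in the application, where \<open>v (g 0) = 0\<close>.
\<close>
lemma subharmonic_le_circle_integral:
  assumes v: "nn_subharmonic v" and g: "g holomorphic_on ball 0 \<rho>" and \<rho>: "\<rho> > 1"
    and dg: "\<And>w. cmod w < 1 \<Longrightarrow> deriv g w \<noteq> 0" and w: "cmod w \<le> 1/2"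
  shows "ennreal (2 * pi * v (g w)) \<le> 3 * (\<integral>\<^sup>+t\<in>{0..2 * pi}. ennreal (v (g (cis t))) \<partial>lborel)"
proof -
  have usc: "usc_on UNIV v" and v0: "\<And>z. 0 \<le> v z" using v by (auto simp: nn_subharmonic_def)
  have sub: "cball 0 1 \<subseteq> ball (0::complex) \<rho>" using \<rho> by auto
  have step: "2 * pi * v (g w) \<le> 3 * integral {0..2 * pi} (\<lambda>t. h (cis t))"
    if h: "continuous_on (sphere 0 1) h" and hv: "\<And>z. cmod z = 1 \<Longrightarrow> v (g z) \<le> h z" for h
  proof (rule field_le_epsilon)
    fix e :: real assume "e > 0"
    (* The approximation error d enters through three times 2 d (polynomial against h) and three times d
       (making the real part strictly positive), each over length 2 pi: 18 pi d in total. *)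
    define d where "d = e / (18 * pi)"
    have d: "d > 0" using \<open>e > 0\<close> by (simp add: d_def)
    obtain p where p: "\<And>z. cmod z = 1 \<Longrightarrow> \<bar>(h z + d) - Re (poly p z)\<bar> < d"
      by (rule Re_poly_dense_unit_circle[of "\<lambda>z. h z + d" d]) (use h d in \<open>auto intro!: continuous_intros\<close>)
    have vp: "v (g y) \<le> Re (poly p y)" if "cmod y \<le> 1" for y
    proof (rule subharmonic_compose_le_Re[OF v compact_cball sub open_ball g])
      show "(\<lambda>y. poly p y) holomorphic_on ball 0 \<rho>" by (intro holomorphic_intros)
      show "y \<in> cball 0 1" using that by simp
      fix x :: complex assume "x \<in> cball 0 1"
      then consider "cmod x < 1" | "cmod x = 1" by force
      then show "x \<in> interior (cball 0 1) \<and> deriv g x \<noteq> 0 \<or> v (g x) \<le> Re (poly p x)"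
        using dg[of x] p[of x] hv[of x] by cases auto
    qed
    have "Re (poly p w + of_real d) \<le> 3 * Re (poly p 0 + of_real d)"
    proof (rule harnack_half_radius[OF _ _ w])
      show "(\<lambda>w. poly p w + of_real d) holomorphic_on ball 0 1" by (intro holomorphic_intros)
      show "0 < Re (poly p y + of_real d)" if "cmod y < 1" for y
        using vp[of y] v0[of "g y"] d that by simp
    qed
    then have 1: "v (g w) \<le> 3 * (Re (poly p 0) + d)" using vp[of w] w d by simp
    have I1: "((\<lambda>t. Re (poly p (cis t))) has_integral 2 * pi * Re (poly p 0)) {0..2 * pi}"
    proof -
      have "(\<lambda>z. poly p z) holomorphic_on cball 0 1" by (intro holomorphic_intros)
      from holomorphic_mean_value[OF this] show ?thesis by simp
    qed
    have I2: "(\<lambda>t. h (cis t)) integrable_on {0..2 * pi}"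
      by (intro integrable_continuous_real continuous_on_compose2[OF h] continuous_intros) auto
    have I3: "((\<lambda>t. h (cis t) + 2 * d) has_integral integral {0..2 * pi} (\<lambda>t. h (cis t)) + 2 * d * (2 * pi)) {0..2 * pi}"
      using has_integral_add[OF integrable_integral[OF I2] has_integral_const_real[of "2 * d" 0 "2 * pi"]]
      by (simp add: mult.commute)
    have "2 * pi * Re (poly p 0) \<le> integral {0..2 * pi} (\<lambda>t. h (cis t)) + 2 * d * (2 * pi)"
    proof (rule has_integral_le[OF I1 I3])
      show "Re (poly p (cis t)) \<le> h (cis t) + 2 * d" for t using p[of "cis t"] by simp
    qed
    moreover have "2 * pi * v (g w) \<le> 2 * pi * (3 * (Re (poly p 0) + d))" using 1 by (intro mult_left_mono) auto
    ultimately have "2 * pi * v (g w) \<le> 3 * integral {0..2 * pi} (\<lambda>t. h (cis t)) + 18 * pi * d"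
      by (simp add: algebra_simps)
    then show "2 * pi * v (g w) \<le> 3 * integral {0..2 * pi} (\<lambda>t. h (cis t)) + e" by (simp add: d_def)
  qed
  have gc: "continuous_on (sphere 0 1) g"
    using g \<rho> by (intro holomorphic_on_imp_continuous_on holomorphic_on_subset[OF g]) auto
  obtain h :: "nat \<Rightarrow> complex \<Rightarrow> real" and M where h: "\<And>n. continuous_on (sphere 0 1) (h n)"
    "\<And>n x. x \<in> sphere 0 1 \<Longrightarrow> v (g x) \<le> h n x" "\<And>n x. x \<in> sphere 0 1 \<Longrightarrow> h n x \<le> M"
    "\<And>x. x \<in> sphere 0 1 \<Longrightarrow> (\<lambda>n. h n x) \<longlonglongrightarrow> v (g x)"
    by (rule usc_continuous_approx[OF compact_sphere[of 0 1] usc_on_compose[OF usc gc]]) (use v0 in auto)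
  have meas: "(\<lambda>t. ennreal (h n (cis t)) * indicator {0..2 * pi} t) \<in> borel_measurable lborel" for n
  proof -
    have "continuous_on UNIV (\<lambda>t. h n (cis t))"
      by (intro continuous_on_compose2[OF h(1)] continuous_intros) auto
    then have "(\<lambda>t. h n (cis t)) \<in> borel_measurable borel" by (rule borel_measurable_continuous_onI)
    then show ?thesis by simp
  qed
  have h0: "0 \<le> h n (cis t)" for n t using h(2)[of "cis t" n] v0[of "g (cis t)"] by simp
  have ineq: "ennreal (2 * pi * v (g w)) \<le> 3 * (\<integral>\<^sup>+t\<in>{0..2 * pi}. ennreal (h n (cis t)) \<partial>lborel)" for n
  proof -
    have I2: "(\<lambda>t. h n (cis t)) integrable_on {0..2 * pi}"
      by (intro integrable_continuous_real continuous_on_compose2[OF h(1)] continuous_intros) auto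
    have "(\<integral>\<^sup>+t\<in>{0..2 * pi}. ennreal (h n (cis t)) \<partial>lborel) = ennreal (integral {0..2 * pi} (\<lambda>t. h n (cis t)))"
      using h0 by (intro set_nn_integral_has_integral integrable_integral I2) auto
    moreover have "0 \<le> integral {0..2 * pi} (\<lambda>t. h n (cis t))"
      using h0 by (intro integral_nonneg I2) auto
    moreover have "2 * pi * v (g w) \<le> 3 * integral {0..2 * pi} (\<lambda>t. h n (cis t))"
      by (rule step) (use h in auto)
    ultimately show ?thesis by (simp add: ennreal_mult'[symmetric] ennreal_leI flip: ennreal_numeral)
  qed
  have "(\<lambda>n. \<integral>\<^sup>+t\<in>{0..2 * pi}. ennreal (h n (cis t)) \<partial>lborel) \<longlonglongrightarrow>
      (\<integral>\<^sup>+t\<in>{0..2 * pi}. ennreal (v (g (cis t))) \<partial>lborel)"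
  proof (rule nn_integral_dominated_convergence[where w = "\<lambda>t. ennreal M * indicator {0..2 * pi} t"])
    show lim: "AE t in lborel. (\<lambda>n. ennreal (h n (cis t)) * indicator {0..2 * pi} t) \<longlonglongrightarrow>
        ennreal (v (g (cis t))) * indicator {0..2 * pi} t"
      by (intro AE_I2) (auto split: split_indicator intro!: tendsto_ennrealI h(4))
    show "AE t in lborel. ennreal (h n (cis t)) * indicator {0..2 * pi} t \<le> ennreal M * indicator {0..2 * pi} t" for n
      by (intro AE_I2 mult_right_mono ennreal_leI h(3)) auto
    show "(\<integral>\<^sup>+t. ennreal M * indicator {0..2 * pi} t \<partial>lborel) < \<infinity>"
      by (simp add: nn_integral_cmult_indicator ennreal_mult_less_top)
    have "(\<lambda>t. g (cis t)) \<in> borel_measurable borel"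
      by (intro borel_measurable_continuous_onI continuous_on_compose2[OF gc] continuous_intros) auto
    then have "(\<lambda>t. v (g (cis t))) \<in> borel_measurable borel"
      using usc_on_borel_measurable[OF usc] by (rule measurable_compose)
    then show "(\<lambda>t. ennreal (v (g (cis t))) * indicator {0..2 * pi} t) \<in> borel_measurable lborel" by simp
  qed (use meas in auto)
  then have "(\<lambda>n. 3 * (\<integral>\<^sup>+t\<in>{0..2 * pi}. ennreal (h n (cis t)) \<partial>lborel)) \<longlonglongrightarrow>
      3 * (\<integral>\<^sup>+t\<in>{0..2 * pi}. ennreal (v (g (cis t))) \<partial>lborel)"
    by (intro ennreal_tendsto_cmult) auto
  then show ?thesis using ineq by (intro LIMSEQ_le_const) auto
qed

section \<open>Logarithmic potentials and the integral condition of class A\<close>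

text \<open>
  Since \<open>ln (\<delta> / y)\<close> is the integral of \<open>1 / \<tau>\<close> over \<open>y < \<tau> < \<delta>\<close>, the integral over \<open>\<theta>\<close> of
  \<open>- ln \<bar>x - N \<theta>\<bar>\<close> is, up to \<open>\<pi> ln (1 / \<delta>)\<close>, the integral over \<open>\<tau>\<close> of \<open>1 / \<tau>\<close> times the length of
  \<open>{\<theta>. \<bar>x - N \<theta>\<bar> < \<tau>}\<close>, and this length is at most \<open>\<mu> (x + \<tau>) - \<mu> (x - \<tau>)\<close> for the inverse \<open>\<mu>\<close>. A positive
  continuous \<open>k\<close> above \<open>\<bar>x - N \<theta>\<bar>\<close> stands in for it: the logarithm then has no singularity, while the
  bound is independent of \<open>k\<close>. In the application \<open>k\<close> is a distance to an interior point of the disc.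
\<close>
lemma log_potential_bound:
  fixes N \<mu> k :: "real \<Rightarrow> real"
  assumes N[measurable]: "N \<in> borel_measurable borel" and \<delta>: "0 < \<delta>" "\<delta> < 1" and A: "A \<ge> 0"
    and inv1: "\<And>\<theta> s. \<theta> \<in> {0..pi} \<Longrightarrow> N \<theta> < s \<Longrightarrow> \<theta> \<le> \<mu> s"
    and inv2: "\<And>\<theta> s. \<theta> \<in> {0..pi} \<Longrightarrow> s < N \<theta> \<Longrightarrow> \<mu> s \<le> \<theta>"
    and bound: "(\<integral>\<^sup>+\<tau>\<in>{0<..<\<delta>}. ennreal ((\<mu> (x + \<tau>) - \<mu> (x - \<tau>)) / \<tau>) \<partial>lborel) \<le> ennreal A"
    and k: "continuous_on {0..pi} k" "\<And>\<theta>. \<theta> \<in> {0..pi} \<Longrightarrow> 0 < k \<theta>"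
      "\<And>\<theta>. \<theta> \<in> {0..pi} \<Longrightarrow> \<bar>x - N \<theta>\<bar> \<le> k \<theta>"
  shows "integral {0..pi} (\<lambda>\<theta>. - ln (k \<theta>)) \<le> pi * ln (1 / \<delta>) + A"
proof -
  define F where "F = (\<lambda>\<theta> \<tau>. if \<theta> \<in> {0..pi} \<and> 0 < \<tau> \<and> \<tau> < \<delta> \<and> \<bar>x - N \<theta>\<bar> < \<tau> then ennreal (1 / \<tau>) else 0)"
  have F[measurable]: "case_prod F \<in> borel_measurable (lborel \<Otimes>\<^sub>M lborel)"
    unfolding F_def by measurable
  have pointwise: "ennreal (max 0 (- ln (k \<theta>))) \<le> ennreal (ln (1 / \<delta>)) + (\<integral>\<^sup>+\<tau>. F \<theta> \<tau> \<partial>lborel)"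
    if \<theta>: "\<theta> \<in> {0..pi}" for \<theta>
  proof (cases "k \<theta> < \<delta>")
    case False
    then have "ln \<delta> \<le> ln (k \<theta>)" using \<delta> by simp
    then have "max 0 (- ln (k \<theta>)) \<le> ln (1 / \<delta>)" using \<delta> by (simp add: ln_div)
    then show ?thesis using add_increasing2[OF _ ennreal_leI] by simp
  next
    case True
    have k0: "0 < k \<theta>" using k \<theta> by simp
    have "((\<lambda>\<tau>. 1 / \<tau>) has_integral (ln \<delta> - ln (k \<theta>))) {k \<theta>..\<delta>}"
      using k0 True by (intro fundamental_theorem_of_calculus)
        (auto simp flip: has_real_derivative_iff_has_vector_derivative intro!: derivative_eq_intros)
    then have "((\<lambda>\<tau>. 1 / \<tau>) has_integral (ln \<delta> - ln (k \<theta>))) {k \<theta><..<\<delta>}"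
      by (simp add: has_integral_Icc_iff_Ioo)
    then have "(\<integral>\<^sup>+\<tau>\<in>{k \<theta><..<\<delta>}. ennreal (1 / \<tau>) \<partial>lborel) = ennreal (ln \<delta> - ln (k \<theta>))"
      using k0 by (intro set_nn_integral_has_integral) auto
    moreover have "(\<integral>\<^sup>+\<tau>\<in>{k \<theta><..<\<delta>}. ennreal (1 / \<tau>) \<partial>lborel) \<le> (\<integral>\<^sup>+\<tau>. F \<theta> \<tau> \<partial>lborel)"
      using k0 k(3)[OF \<theta>] \<theta> by (intro nn_integral_mono) (auto simp: F_def split: split_indicator)
    ultimately have "ennreal (ln (1 / \<delta>)) + ennreal (ln \<delta> - ln (k \<theta>)) \<le>
        ennreal (ln (1 / \<delta>)) + (\<integral>\<^sup>+\<tau>. F \<theta> \<tau> \<partial>lborel)"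
      by (intro add_left_mono) simp
    moreover have "ln (k \<theta>) < ln \<delta>" "ln \<delta> < 0" using True k0 \<delta> by auto
    then have "ennreal (ln (1 / \<delta>)) + ennreal (ln \<delta> - ln (k \<theta>)) = ennreal (max 0 (- ln (k \<theta>)))"
      using \<delta> by (subst ennreal_plus[symmetric]) (auto simp: ln_div)
    ultimately show ?thesis by simp
  qed
  have inner: "(\<integral>\<^sup>+\<theta>. F \<theta> \<tau> \<partial>lborel) \<le> ennreal ((\<mu> (x + \<tau>) - \<mu> (x - \<tau>)) / \<tau>) * indicator {0<..<\<delta>} \<tau>" for \<tau>
  proof (cases "0 < \<tau> \<and> \<tau> < \<delta>")
    case True
    have "F \<theta> \<tau> \<le> ennreal (1 / \<tau>) * indicator {\<mu> (x - \<tau>)..\<mu> (x + \<tau>)} \<theta>" for \<theta>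
      using inv1[of \<theta> "x + \<tau>"] inv2[of \<theta> "x - \<tau>"] by (auto simp: F_def abs_less_iff)
    then have "(\<integral>\<^sup>+\<theta>. F \<theta> \<tau> \<partial>lborel) \<le> (\<integral>\<^sup>+\<theta>. ennreal (1 / \<tau>) * indicator {\<mu> (x - \<tau>)..\<mu> (x + \<tau>)} \<theta> \<partial>lborel)"
      by (rule nn_integral_mono)
    also have "\<dots> = ennreal (1 / \<tau>) * emeasure lborel {\<mu> (x - \<tau>)..\<mu> (x + \<tau>)}"
      by (subst nn_integral_cmult_indicator) auto
    also have "\<dots> \<le> ennreal (1 / \<tau>) * ennreal (\<mu> (x + \<tau>) - \<mu> (x - \<tau>))"
      by (intro mult_left_mono) (auto simp: emeasure_lborel_Icc_eq)
    also have "\<dots> = ennreal ((\<mu> (x + \<tau>) - \<mu> (x - \<tau>)) / \<tau>)"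
      using True by (subst ennreal_mult'[symmetric]) auto
    finally show ?thesis using True by simp
  next
    case False
    then have "F \<theta> \<tau> = 0" for \<theta> by (auto simp: F_def)
    then show ?thesis by simp
  qed
  have int_ln: "(\<lambda>\<theta>. - ln (k \<theta>)) integrable_on {0..pi}"
    and int_max: "(\<lambda>\<theta>. max 0 (- ln (k \<theta>))) integrable_on {0..pi}"
    by (intro integrable_continuous_real continuous_intros k; use k(2) in force)+
  have "ennreal (integral {0..pi} (\<lambda>\<theta>. max 0 (- ln (k \<theta>)))) =
      (\<integral>\<^sup>+\<theta>\<in>{0..pi}. ennreal (max 0 (- ln (k \<theta>))) \<partial>lborel)"
    by (intro set_nn_integral_has_integral[symmetric] integrable_integral int_max) auto
  also have "\<dots> \<le> (\<integral>\<^sup>+\<theta>. ennreal (ln (1 / \<delta>)) * indicator {0..pi} \<theta> + (\<integral>\<^sup>+\<tau>. F \<theta> \<tau> \<partial>lborel) \<partial>lborel)"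
    using pointwise by (intro nn_integral_mono) (auto split: split_indicator)
  also have "\<dots> = (\<integral>\<^sup>+\<theta>. ennreal (ln (1 / \<delta>)) * indicator {0..pi} \<theta> \<partial>lborel) + (\<integral>\<^sup>+\<theta>. \<integral>\<^sup>+\<tau>. F \<theta> \<tau> \<partial>lborel \<partial>lborel)"
    by (intro nn_integral_add) measurable
  also have "\<dots> \<le> ennreal (pi * ln (1 / \<delta>)) + ennreal A"
  proof (rule add_mono)
    show "(\<integral>\<^sup>+\<theta>. ennreal (ln (1 / \<delta>)) * indicator {0..pi} \<theta> \<partial>lborel) \<le> ennreal (pi * ln (1 / \<delta>))"
      using \<delta> by (subst nn_integral_cmult_indicator) (auto simp: ennreal_mult'' mult.commute)
    have "(\<integral>\<^sup>+\<theta>. \<integral>\<^sup>+\<tau>. F \<theta> \<tau> \<partial>lborel \<partial>lborel) = (\<integral>\<^sup>+\<tau>. \<integral>\<^sup>+\<theta>. F \<theta> \<tau> \<partial>lborel \<partial>lborel)"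
      by (rule lborel_pair.Fubini') (use F in \<open>simp add: case_prod_unfold measurable_split_conv\<close>)
    also have "\<dots> \<le> (\<integral>\<^sup>+\<tau>\<in>{0<..<\<delta>}. ennreal ((\<mu> (x + \<tau>) - \<mu> (x - \<tau>)) / \<tau>) \<partial>lborel)"
      by (intro nn_integral_mono inner)
    also have "\<dots> \<le> ennreal A" by (rule bound)
    finally show "(\<integral>\<^sup>+\<theta>. \<integral>\<^sup>+\<tau>. F \<theta> \<tau> \<partial>lborel \<partial>lborel) \<le> ennreal A" .
  qed
  also have "\<dots> = ennreal (pi * ln (1 / \<delta>) + A)"
    using \<delta> A by (intro ennreal_plus[symmetric]) auto
  finally have "integral {0..pi} (\<lambda>\<theta>. max 0 (- ln (k \<theta>))) \<le> pi * ln (1 / \<delta>) + A"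
    using \<delta> A by (subst (asm) ennreal_le_iff) (auto intro!: add_nonneg_nonneg mult_nonneg_nonneg)
  moreover have "integral {0..pi} (\<lambda>\<theta>. - ln (k \<theta>)) \<le> integral {0..pi} (\<lambda>\<theta>. max 0 (- ln (k \<theta>)))"
    by (intro integral_le int_ln int_max) auto
  ultimately show ?thesis by simp
qed

section \<open>A starlike map with prescribed radial projection\<close>

lemma sin_ge_chord:
  assumes "0 \<le> y" "y \<le> pi / 2"
  shows "2 * y / pi \<le> sin y"
proof -
  have "convex_on {0..pi/2} (\<lambda>y. - sin y)"
  proof (rule f''_ge0_imp_convex)
    show "((\<lambda>y. - sin y) has_real_derivative - cos x) (at x)" for x
      by (auto intro!: derivative_eq_intros)
    show "((\<lambda>y. - cos y) has_real_derivative sin x) (at x)" for x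
      by (auto intro!: derivative_eq_intros)
    show "0 \<le> sin x" if "x \<in> {0..pi/2}" for x using that by (intro sin_ge_zero) auto
  qed simp
  from convex_onD[OF this, of "2 * y / pi" 0 "pi / 2"] assms show ?thesis
    by (simp add: field_simps)
qed

text \<open>
  The distance from \<open>1\<close> to \<open>r e\<^sup>i\<^sup>s\<close> is at least half the distance from \<open>1\<close> to \<open>e\<^sup>i\<^sup>s\<close>, uniformly in \<open>r\<close>. This is
  what makes the bound on \<open>g\<close> uniform up to the boundary.
\<close>
lemma one_minus_rcis_ge:
  assumes "\<bar>s\<bar> \<le> pi" "0 \<le> r"
  shows "\<bar>s\<bar> / pi \<le> cmod (1 - of_real r * cis s)"
proof -
  have "cmod (1 - cis s) \<le> cmod (1 - of_real r * cis s) + cmod (of_real r * cis s - cis s)"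
    using norm_triangle_ineq[of "1 - of_real r * cis s" "of_real r * cis s - cis s"] by simp
  also have "of_real r * cis s - cis s = of_real (r - 1) * cis s" by (simp add: algebra_simps)
  also have "cmod (of_real (r - 1) * cis s) = \<bar>1 - r\<bar>"
    by (simp only: norm_mult norm_cis norm_of_real) simp
  also have "\<bar>1 - r\<bar> \<le> cmod (1 - of_real r * cis s)"
    using norm_triangle_ineq3[of 1 "of_real r * cis s"] assms by (simp add: norm_mult)
  finally have 1: "cmod (1 - cis s) \<le> 2 * cmod (1 - of_real r * cis s)" by simp
  have "cos s = 1 - 2 * (sin (s / 2))\<^sup>2" using cos_double_sin[of "s / 2"] by simp
  then have "(cmod (1 - cis s))\<^sup>2 = (2 * sin (\<bar>s\<bar> / 2))\<^sup>2"
    using sin_cos_squared_add[of s] unfolding cmod_power2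
    by (simp add: power_mult_distrib abs_if power2_eq_square algebra_simps)
  moreover have s: "2 * (\<bar>s\<bar> / 2) / pi \<le> sin (\<bar>s\<bar> / 2)" using assms by (intro sin_ge_chord) auto
  moreover have "0 \<le> sin (\<bar>s\<bar> / 2)" using assms by (intro sin_ge_zero) auto
  ultimately have "cmod (1 - cis s) = 2 * sin (\<bar>s\<bar> / 2)"
    using power2_eq_imp_eq[of "cmod (1 - cis s)" "2 * sin (\<bar>s\<bar> / 2)"] norm_ge_zero[of "1 - cis s"]
    by (meson mult_nonneg_nonneg zero_le_numeral)
  then show ?thesis using 1 s by simp
qed

text \<open>The chord \<open>1 - e\<^sup>i\<^sup>s\<close> is \<open>2 sin (s/2) e\<^sup>i\<^sup>(\<^sup>s\<^sup>-\<^sup>\<pi>\<^sup>)\<^sup>/\<^sup>2\<close>.\<close>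
lemma Im_Ln_one_minus_cis:
  assumes "0 < s" "s < 2 * pi"
  shows "Im (Ln (1 - cis s)) = (s - pi) / 2"
proof -
  have pos: "0 < sin (s / 2)" using assms by (intro sin_gt_zero) auto
  define z where "z = Complex (ln (2 * sin (s / 2))) ((s - pi) / 2)"
  have c: "cos s = 1 - 2 * (sin (s / 2))\<^sup>2" using cos_double_sin[of "s / 2"] by simp
  have d: "sin s = 2 * sin (s / 2) * cos (s / 2)" using sin_double[of "s / 2"] by simp
  have e: "cos ((s - pi) / 2) = sin (s / 2)" "sin ((s - pi) / 2) = - cos (s / 2)"
    by (simp_all add: diff_divide_distrib cos_diff sin_diff)
  have "exp z = 1 - cis s"
    using pos by (simp add: z_def complex_eq_iff Re_exp Im_exp e c d power2_eq_square)
  moreover have "Ln (exp z) = z" using assms by (intro Ln_exp) (auto simp: z_def)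
  ultimately have "Ln (1 - cis s) = z" by simp
  then show ?thesis by (simp add: z_def)
qed

lemma Im_Ln_one_minus_cis_neg:
  assumes "- 2 * pi < s" "s < 0"
  shows "Im (Ln (1 - cis s)) = (s + pi) / 2"
proof -
  have *: "Im (Ln (1 - cis (- s))) = (- s - pi) / 2" using assms by (intro Im_Ln_one_minus_cis) auto
  have "1 - cis (- s) \<notin> \<real>\<^sub>\<le>\<^sub>0"
  proof
    assume "1 - cis (- s) \<in> \<real>\<^sub>\<le>\<^sub>0"
    then have "1 \<le> cos s" by (auto simp: complex_nonpos_Reals_iff)
    moreover have "cos s = 1 - 2 * (sin (- s / 2))\<^sup>2" using cos_double_sin[of "s / 2"] by simp
    moreover have "0 < sin (- s / 2)" using assms by (intro sin_gt_zero) auto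
    ultimately show False by (simp add: not_less[symmetric])
  qed
  then have "cnj (Ln (1 - cis (- s))) = Ln (1 - cis s)" by (simp add: cnj_Ln cis_cnj)
  then have "Im (Ln (1 - cis s)) = - Im (Ln (1 - cis (- s)))" by (metis cnj.sel(2))
  then show ?thesis unfolding * by (simp add: field_simps)
qed

lemma one_minus_notin_nonpos:
  assumes "cmod \<zeta> < 1"
  shows "1 - \<zeta> \<notin> \<real>\<^sub>\<le>\<^sub>0" "1 - \<zeta> \<noteq> 0"
  using assms complex_Re_le_cmod[of \<zeta>] by (auto simp: complex_nonpos_Reals_iff)

text \<open>
  After clearing denominators with \<open>\<rho> = \<bar>\<zeta>\<bar>\<close> and \<open>x = Re \<zeta>\<close> this is \<open>0 \<le> (x + \<rho>) (1 - \<rho>)\<close>. The lower bound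
  is larger than \<open>- 1/2\<close>, which is what starlikeness of \<open>g\<close> needs.
\<close>
lemma Re_div_one_minus_ge:
  assumes "cmod \<zeta> < 1"
  shows "- cmod \<zeta> / (1 + cmod \<zeta>) \<le> Re (\<zeta> / (1 - \<zeta>))"
proof -
  define \<rho> x where "\<rho> = cmod \<zeta>" and "x = Re \<zeta>"
  have \<rho>: "0 \<le> \<rho>" "\<rho> < 1" "- \<rho> \<le> x" using assms abs_Re_le_cmod[of \<zeta>] by (auto simp: \<rho>_def x_def)
  have sq: "(Re \<zeta>)\<^sup>2 + (Im \<zeta>)\<^sup>2 = \<rho>\<^sup>2" by (simp add: \<rho>_def cmod_power2)
  have d: "(1 - Re \<zeta>)\<^sup>2 + (Im \<zeta>)\<^sup>2 = 1 - 2 * x + \<rho>\<^sup>2"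
    using sq by (simp add: x_def power2_eq_square algebra_simps)
  have pos: "0 < 1 - 2 * x + \<rho>\<^sup>2"
  proof -
    have "x \<le> \<rho>" using complex_Re_le_cmod[of \<zeta>] by (simp add: x_def \<rho>_def)
    moreover have "0 < (1 - \<rho>)\<^sup>2" using \<rho> by simp
    ultimately show ?thesis by (simp add: power2_eq_square algebra_simps)
  qed
  have "Re (\<zeta> / (1 - \<zeta>)) = (x - \<rho>\<^sup>2) / (1 - 2 * x + \<rho>\<^sup>2)"
    unfolding Re_divide using d sq by (simp add: x_def power2_eq_square algebra_simps)
  moreover have "0 \<le> (x + \<rho>) * (1 - \<rho>)" using \<rho> by simp
  then have "0 \<le> (x - \<rho>\<^sup>2) * (1 + \<rho>) + \<rho> * (1 - 2 * x + \<rho>\<^sup>2)"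
    by (simp add: power2_eq_square algebra_simps)
  then have "- \<rho> / (1 + \<rho>) \<le> (x - \<rho>\<^sup>2) / (1 - 2 * x + \<rho>\<^sup>2)"
    using pos \<rho> by (subst divide_le_eq, simp) (simp add: field_simps)
  ultimately show ?thesis by (simp add: \<rho>_def)
qed


text \<open>
  A continuous strictly increasing distribution function on \<open>[0,\<pi>]\<close> prescribes the boundary argument of
  a map: the boundary point \<open>e\<^sup>i\<^sup>\<pi>\<^sup>N\<^sup>(\<^sup>\<alpha>\<^sup>)\<close> is to be sent to a point with argument \<open>\<alpha>\<close>.
\<close>
locale angular_profile =
  fixes N :: "real \<Rightarrow> real"
  assumes N_cont: "continuous_on {0..pi} N"
    and N_mono: "strict_mono_on {0..pi} N"
    and N_0: "N 0 = 0" and N_pi: "N pi = 1"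
begin

definition e :: "real \<Rightarrow> complex" where "e \<theta> = cis (pi * N \<theta>)"

text \<open>
  The exponent in the classical representation of starlike functions,
  \<open>g w = w exp (- 2 \<integral> Ln (1 - e\<^sup>-\<^sup>i\<^sup>s w) dm(s))\<close>, where \<open>m\<close> is the image of normalised arc length under the
  odd extension of \<open>\<theta> \<mapsto> \<pi> N \<theta>\<close>. Parametrised by \<open>\<theta>\<close> the integral is over Lebesgue measure with a
  continuous integrand.
\<close>
definition q :: "complex \<Rightarrow> complex" where
  "q w = - (1 / of_real pi) * integral {0..pi} (\<lambda>\<theta>. Ln (1 - cnj (e \<theta>) * w) + Ln (1 - e \<theta> * w))"

definition g :: "complex \<Rightarrow> complex" where "g w = w * exp (q w)"

lemma N_range: "\<theta> \<in> {0..pi} \<Longrightarrow> 0 \<le> N \<theta> \<and> N \<theta> \<le> 1"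
  using strict_mono_on_leD[OF N_mono, of 0 \<theta>] strict_mono_on_leD[OF N_mono, of \<theta> pi] N_0 N_pi by auto

lemma norm_e [simp]: "cmod (e \<theta>) = 1" by (simp add: e_def)

lemma e_cont: "continuous_on {0..pi} e"
  unfolding e_def by (intro continuous_intros N_cont)

lemma q_integrand_cont:
  assumes "cmod w < 1"
  shows "continuous_on {0..pi} (\<lambda>\<theta>. Ln (1 - cnj (e \<theta>) * w))" "continuous_on {0..pi} (\<lambda>\<theta>. Ln (1 - e \<theta> * w))"
  by (intro continuous_intros e_cont one_minus_notin_nonpos; simp add: norm_mult assms)+

lemma q_integrand_integrable:
  assumes "cmod w < 1"
  shows "(\<lambda>\<theta>. Ln (1 - cnj (e \<theta>) * w) + Ln (1 - e \<theta> * w)) integrable_on {0..pi}"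
  by (intro integrable_continuous_real continuous_on_add q_integrand_cont assms)

lemma q_has_field_derivative:
  assumes w: "cmod w < 1"
  shows "(q has_field_derivative (1 / of_real pi) *
     integral {0..pi} (\<lambda>\<theta>. cnj (e \<theta>) / (1 - cnj (e \<theta>) * w) + e \<theta> / (1 - e \<theta> * w))) (at w)"
proof -
  define D where "D = (\<lambda>w \<theta>. - (cnj (e \<theta>) / (1 - cnj (e \<theta>) * w) + e \<theta> / (1 - e \<theta> * w)))"
  have "((\<lambda>w. integral (cbox 0 pi) (\<lambda>\<theta>. Ln (1 - cnj (e \<theta>) * w) + Ln (1 - e \<theta> * w)))
      has_field_derivative integral (cbox 0 pi) (D w)) (at w within ball 0 1)"
  proof (rule leibniz_rule_field_derivative)
    show "((\<lambda>w. Ln (1 - cnj (e \<theta>) * w) + Ln (1 - e \<theta> * w)) has_field_derivative D x \<theta>) (at x within ball 0 1)"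
      if "x \<in> ball 0 1" "\<theta> \<in> cbox 0 pi" for x \<theta>
    proof -
      have x: "cmod (cnj (e \<theta>) * x) < 1" "cmod (e \<theta> * x) < 1" using that by (auto simp: norm_mult)
      have d: "((\<lambda>x. Ln (1 - c * x)) has_field_derivative - (c / (1 - c * x))) (at x within ball 0 1)"
        if "1 - c * x \<notin> \<real>\<^sub>\<le>\<^sub>0" for c
        using that by (auto intro!: derivative_eq_intros simp: divide_inverse mult.commute)
      show ?thesis unfolding D_def minus_add_distrib
        by (intro DERIV_add d one_minus_notin_nonpos x)
    qed
    show "(\<lambda>\<theta>. Ln (1 - cnj (e \<theta>) * x) + Ln (1 - e \<theta> * x)) integrable_on cbox 0 pi" if "x \<in> ball 0 1" for x
      using q_integrand_integrable[of x] that by simp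
    have c: "continuous_on (ball (0::complex) 1 \<times> cbox 0 pi) (\<lambda>p. e (snd p))"
      by (intro continuous_on_compose2[OF e_cont] continuous_intros) auto
    show "continuous_on (ball 0 1 \<times> cbox 0 pi) (\<lambda>(x, \<theta>). D x \<theta>)"
      unfolding D_def case_prod_unfold
      by (intro continuous_intros c ballI one_minus_notin_nonpos) (auto simp: norm_mult)
  qed (use w in auto)
  then have "((\<lambda>w. integral {0..pi} (\<lambda>\<theta>. Ln (1 - cnj (e \<theta>) * w) + Ln (1 - e \<theta> * w)))
      has_field_derivative integral {0..pi} (D w)) (at w)"
    using w by (subst (asm) at_within_open) auto
  moreover have "integral {0..pi} (D w) =
      - integral {0..pi} (\<lambda>\<theta>. cnj (e \<theta>) / (1 - cnj (e \<theta>) * w) + e \<theta> / (1 - e \<theta> * w))"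
    unfolding D_def by (rule integral_neg)
  ultimately have "((\<lambda>w. integral {0..pi} (\<lambda>\<theta>. Ln (1 - cnj (e \<theta>) * w) + Ln (1 - e \<theta> * w))) has_field_derivative
      - integral {0..pi} (\<lambda>\<theta>. cnj (e \<theta>) / (1 - cnj (e \<theta>) * w) + e \<theta> / (1 - e \<theta> * w))) (at w)"
    by simp
  from DERIV_cmult[OF this, of "- (1 / of_real pi)"] show ?thesis
    unfolding q_def[abs_def] by simp
qed

text \<open>
  The real part of \<open>w g' / g = 1 + w q'\<close> is positive (\<open>g\<close> is starlike), since \<open>w q'\<close> is the average of terms
  \<open>\<zeta> / (1 - \<zeta>)\<close> taken in conjugate pairs. In particular \<open>g\<close> is locally injective, at \<open>0\<close> too.
\<close>
lemma g_has_field_derivative: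
  assumes w: "cmod w < 1"
  obtains d where "(g has_field_derivative d) (at w)" "d \<noteq> 0"
proof -
  define I where "I = (\<lambda>\<theta>. cnj (e \<theta>) / (1 - cnj (e \<theta>) * w) + e \<theta> / (1 - e \<theta> * w))"
  define q' where "q' = (1 / of_real pi) * integral {0..pi} I"
  have q': "(q has_field_derivative q') (at w)"
    unfolding q'_def I_def by (rule q_has_field_derivative[OF w])
  have g': "(g has_field_derivative exp (q w) * (1 + w * q')) (at w)"
    unfolding g_def[abs_def] using q' by (auto intro!: derivative_eq_intros simp: algebra_simps)
  have n: "cmod (cnj (e \<theta>) * w) < 1" "cmod (e \<theta> * w) < 1" for \<theta> using w by (auto simp: norm_mult)
  have Ic: "continuous_on {0..pi} I" unfolding I_def
    by (intro continuous_intros e_cont ballI one_minus_notin_nonpos n)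
  define b where "b = cmod w / (1 + cmod w)"
  have wI: "((\<lambda>\<theta>. Re (w * I \<theta>)) has_integral Re (w * integral {0..pi} I)) {0..pi}"
    using has_integral_linear[OF has_integral_mult_right[OF integrable_integral[OF integrable_continuous_real[OF Ic]], of w]
      bounded_linear_Re] by (simp add: o_def)
  have "((\<lambda>\<theta>. - 2 * b) has_integral (- 2 * b) * pi) {0..pi}"
    using has_integral_const_real[of "- 2 * b" 0 pi] by (simp add: mult.commute)
  then have "(- 2 * b) * pi \<le> Re (w * integral {0..pi} I)"
  proof (rule has_integral_le[OF _ wI])
    fix \<theta>
    have "- 2 * b \<le> Re (cnj (e \<theta>) * w / (1 - cnj (e \<theta>) * w)) + Re (e \<theta> * w / (1 - e \<theta> * w))"
      using Re_div_one_minus_ge[OF n(1)[of \<theta>]] Re_div_one_minus_ge[OF n(2)[of \<theta>]]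
      by (simp add: norm_mult b_def)
    also have "\<dots> = Re (w * I \<theta>)" by (simp add: I_def distrib_left mult.commute)
    finally show "- 2 * b \<le> Re (w * I \<theta>)" .
  qed
  moreover have "b < 1 / 2" unfolding b_def using w by (subst pos_divide_less_eq) (auto simp: add_pos_nonneg)
  then have "- 1 * pi < (- 2 * b) * pi" by (intro mult_strict_right_mono) auto
  ultimately have "- 1 * pi < Re (w * integral {0..pi} I)" by linarith
  then have "- 1 < Re (w * integral {0..pi} I) / pi" by (subst pos_less_divide_eq) auto
  moreover have "Re (w * q') = Re (w * integral {0..pi} I) / pi"
    unfolding q'_def by (simp add: Re_divide_of_real)
  ultimately have "0 < Re (1 + w * q')" unfolding plus_complex.sel one_complex.sel by linarith
  then have "1 + w * q' \<noteq> 0" by (metis less_irrefl zero_complex.simps(1))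
  then show ?thesis using that[OF g'] by simp
qed

lemma g_holomorphic: "g holomorphic_on ball 0 1"
  by (rule holomorphic_onI) (metis dist_0_norm g_has_field_derivative mem_ball field_differentiable_def field_differentiable_at_within)

lemma deriv_g_nonzero: "cmod w < 1 \<Longrightarrow> deriv g w \<noteq> 0"
  by (metis DERIV_imp_deriv g_has_field_derivative)

lemma g_0 [simp]: "g 0 = 0" by (simp add: g_def)

lemma g_image_contains_ball:
  assumes "r > 0"
  obtains c where "c > 0" "ball 0 c \<subseteq> g ` ball 0 r"
proof -
  define S where "S = ball (0::complex) (min r 1)"
  have gS: "g holomorphic_on S" using g_holomorphic by (rule holomorphic_on_subset) (auto simp: S_def)
  have "0 \<in> S" "open S" "deriv g 0 \<noteq> 0" using assms deriv_g_nonzero by (auto simp: S_def)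
  then obtain s where s: "s > 0" "ball 0 s \<subseteq> S" "open (g ` ball 0 s)"
    using has_complex_derivative_locally_invertible[OF gS] by metis
  have "0 \<in> g ` ball 0 s" using s g_0 by (metis centre_in_ball image_eqI)
  then obtain c where "c > 0" "ball 0 c \<subseteq> g ` ball 0 s" using s(3) open_contains_ball by metis
  moreover have "g ` ball 0 s \<subseteq> g ` ball 0 r" using s by (intro image_mono) (auto simp: S_def)
  ultimately show ?thesis using that by blast
qed

lemma q_cnj: assumes "cmod w < 1" shows "q (cnj w) = cnj (q w)"
proof -
  have "cnj (integral {0..pi} (\<lambda>\<theta>. Ln (1 - cnj (e \<theta>) * w) + Ln (1 - e \<theta> * w))) =
      integral {0..pi} (\<lambda>\<theta>. cnj (Ln (1 - cnj (e \<theta>) * w) + Ln (1 - e \<theta> * w)))"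
    using integral_linear[OF q_integrand_integrable[OF assms] bounded_linear_cnj] by (simp add: o_def)
  also have "\<dots> = integral {0..pi} (\<lambda>\<theta>. Ln (1 - cnj (e \<theta>) * cnj w) + Ln (1 - e \<theta> * cnj w))"
  proof (rule integral_cong)
    fix \<theta>
    have "1 - cnj (e \<theta>) * w \<notin> \<real>\<^sub>\<le>\<^sub>0" "1 - e \<theta> * w \<notin> \<real>\<^sub>\<le>\<^sub>0"
      by (rule one_minus_notin_nonpos; simp add: norm_mult assms)+
    then show "cnj (Ln (1 - cnj (e \<theta>) * w) + Ln (1 - e \<theta> * w)) = Ln (1 - cnj (e \<theta>) * cnj w) + Ln (1 - e \<theta> * cnj w)"
      by (simp add: cnj_Ln add.commute)
  qed
  finally show ?thesis by (simp add: q_def)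
qed

lemma g_cnj: "cmod w < 1 \<Longrightarrow> g (cnj w) = cnj (g w)"
  by (simp add: g_def q_cnj exp_cnj)

lemma Re_q:
  assumes w: "cmod w < 1"
  shows "((\<lambda>\<theta>. - ln (cmod (1 - cnj (e \<theta>) * w)) - ln (cmod (1 - e \<theta> * w))) has_integral pi * Re (q w)) {0..pi}"
proof -
  have "((\<lambda>\<theta>. Re (- (Ln (1 - cnj (e \<theta>) * w) + Ln (1 - e \<theta> * w)))) has_integral
      Re (- integral {0..pi} (\<lambda>\<theta>. Ln (1 - cnj (e \<theta>) * w) + Ln (1 - e \<theta> * w)))) {0..pi}"
    using has_integral_linear[OF has_integral_neg[OF integrable_integral[OF q_integrand_integrable[OF w]]] bounded_linear_Re]
    by (simp add: o_def)
  moreover have "Re (- (Ln (1 - cnj (e \<theta>) * w) + Ln (1 - e \<theta> * w))) =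
      - ln (cmod (1 - cnj (e \<theta>) * w)) - ln (cmod (1 - e \<theta> * w))" for \<theta>
  proof -
    have "1 - cnj (e \<theta>) * w \<noteq> 0" "1 - e \<theta> * w \<noteq> 0"
      by (rule one_minus_notin_nonpos; simp add: norm_mult w)+
    then show ?thesis by simp
  qed
  moreover have "Re (- integral {0..pi} (\<lambda>\<theta>. Ln (1 - cnj (e \<theta>) * w) + Ln (1 - e \<theta> * w))) = pi * Re (q w)"
    unfolding q_def by (simp add: Re_divide_of_real)
  ultimately show ?thesis by simp
qed

lemma norm_g: "cmod (g w) = cmod w * exp (Re (q w))"
  by (simp add: g_def norm_mult)

lemma norm_g_ge:
  assumes w: "cmod w < 1"
  shows "cmod w / 4 \<le> cmod (g w)"
proof -
  have "- ln (2::real) - ln 2 \<le> - ln (cmod (1 - cnj (e \<theta>) * w)) - ln (cmod (1 - e \<theta> * w))" for \<theta>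
  proof -
    have n: "cmod (cnj (e \<theta>) * w) < 1" "cmod (e \<theta> * w) < 1" using w by (auto simp: norm_mult)
    have "cmod (1 - \<zeta>) \<le> 2" if "cmod \<zeta> < 1" for \<zeta>
      using norm_triangle_ineq4[of 1 \<zeta>] that by simp
    then have "ln (cmod (1 - \<zeta>)) \<le> ln 2" if "cmod \<zeta> < 1" for \<zeta>
      using one_minus_notin_nonpos(2)[OF that] that by simp
    from this[OF n(1)] this[OF n(2)] show ?thesis by simp
  qed
  from has_integral_le[OF has_integral_const_real[of "- ln 2 - ln 2" 0 pi] Re_q[OF w] this]
  have "pi * (- ln 2 - ln 2) \<le> pi * Re (q w)" by simp
  then have "- ln 2 - ln 2 \<le> Re (q w)" by (subst (asm) mult_le_cancel_left_pos) auto
  then have "exp (- ln 2 - ln 2) \<le> exp (Re (q w))" by simp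
  moreover have "exp (- ln 2 - ln (2::real)) = 1 / 4"
    unfolding exp_diff exp_minus exp_ln[OF zero_less_numeral] by simp
  ultimately have "1 / 4 \<le> exp (Re (q w))" by linarith
  then show ?thesis using mult_left_mono[of "1/4" "exp (Re (q w))" "cmod w"] by (simp add: norm_g)
qed

text \<open>
  For \<open>w = r e\<^sup>i\<^sup>t\<close> in the closed upper half disc both kernels are at least \<open>\<bar>t/\<pi> - N \<theta>\<bar>\<close> in modulus, the
  second because \<open>w\<close> is nearer to the upper than to the lower of two conjugate points. So twice a
  potential of the distribution of \<open>N\<close> bounds \<open>\<pi> ln \<bar>g w / w\<bar>\<close>; the lower half disc follows by symmetry.
\<close>
lemma norm_g_le:
  assumes B: "\<And>k x. 0 \<le> x \<Longrightarrow> x \<le> 1 \<Longrightarrow> continuous_on {0..pi} k \<Longrightarrow>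
      (\<And>\<theta>. \<theta> \<in> {0..pi} \<Longrightarrow> 0 < k \<theta> \<and> \<bar>x - N \<theta>\<bar> \<le> k \<theta>) \<Longrightarrow> integral {0..pi} (\<lambda>\<theta>. - ln (k \<theta>)) \<le> B"
    and w: "cmod w < 1"
  shows "cmod (g w) \<le> cmod w * exp (2 * B / pi)"
proof -
  have upper: "cmod (g w) \<le> cmod w * exp (2 * B / pi)" if w: "cmod w < 1" and Im: "0 \<le> Im w" for w
  proof (cases "w = 0")
    case False
    define t where "t = Arg w"
    have t: "0 \<le> t" "t \<le> pi" using Im by (auto simp: t_def Arg_le_pi Arg_less_0)
    have wt: "w = of_real (cmod w) * cis t" unfolding t_def using rcis_cmod_Arg[of w] by (simp add: rcis_def)
    have n: "cmod (cnj (e \<theta>) * w) < 1" "cmod (e \<theta> * w) < 1" for \<theta> using w by (auto simp: norm_mult)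
    have k1: "\<bar>t / pi - N \<theta>\<bar> \<le> cmod (1 - cnj (e \<theta>) * w)" if \<theta>: "\<theta> \<in> {0..pi}" for \<theta>
    proof -
      have N: "0 \<le> pi * N \<theta>" "pi * N \<theta> \<le> pi" using N_range[OF \<theta>] by auto
      have "cnj (e \<theta>) * w = of_real (cmod w) * cis (t - pi * N \<theta>)"
        by (subst wt) (simp add: e_def cis_cnj cis_mult)
      then have "\<bar>t - pi * N \<theta>\<bar> / pi \<le> cmod (1 - cnj (e \<theta>) * w)"
        using one_minus_rcis_ge[of "t - pi * N \<theta>" "cmod w"] t N unfolding abs_le_iff by simp
      moreover have "t / pi - N \<theta> = (t - pi * N \<theta>) / pi" by (simp add: field_simps)
      ultimately show ?thesis by (simp add: abs_divide)
    qed
    have k2: "cmod (1 - cnj (e \<theta>) * w) \<le> cmod (1 - e \<theta> * w)" if \<theta>: "\<theta> \<in> {0..pi}" for \<theta>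
    proof -
      have "0 \<le> Im (e \<theta>)" using N_range[OF \<theta>] unfolding e_def by (auto intro!: sin_ge_zero)
      then have "0 \<le> Im (e \<theta>) * Im w" using Im by simp
      then have "(cmod (1 - cnj (e \<theta>) * w))\<^sup>2 \<le> (cmod (1 - e \<theta> * w))\<^sup>2"
        unfolding cmod_power2 by (simp add: power2_eq_square algebra_simps)
      then show ?thesis by (rule power2_le_imp_le) simp
    qed
    have c: "continuous_on {0..pi} (\<lambda>\<theta>. cmod (1 - cnj (e \<theta>) * w))" "continuous_on {0..pi} (\<lambda>\<theta>. cmod (1 - e \<theta> * w))"
      by (intro continuous_intros e_cont)+
    have pos: "0 < cmod (1 - cnj (e \<theta>) * w)" "0 < cmod (1 - e \<theta> * w)" for \<theta>
      using one_minus_notin_nonpos[OF n(1)] one_minus_notin_nonpos[OF n(2)] by auto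
    have x: "0 \<le> t / pi" "t / pi \<le> 1" using t by auto
    have i1: "(\<lambda>\<theta>. - ln (cmod (1 - cnj (e \<theta>) * w))) integrable_on {0..pi}"
      and i2: "(\<lambda>\<theta>. - ln (cmod (1 - e \<theta> * w))) integrable_on {0..pi}"
      by (intro integrable_continuous_real continuous_intros c; use pos in force)+
    have "pi * Re (q w) = integral {0..pi} (\<lambda>\<theta>. - ln (cmod (1 - cnj (e \<theta>) * w))) + integral {0..pi} (\<lambda>\<theta>. - ln (cmod (1 - e \<theta> * w)))"
      using has_integral_unique[OF Re_q[OF w]] has_integral_add[OF integrable_integral[OF i1] integrable_integral[OF i2]]
      by simp
    also have "\<dots> \<le> B + B"
      by (intro add_mono B[OF x] c conjI pos) (use k1 k2 in \<open>auto intro: order_trans\<close>)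
    finally have "Re (q w) \<le> 2 * B / pi" by (simp add: field_simps)
    then show ?thesis by (simp add: norm_g mult_left_mono)
  qed simp
  show ?thesis
  proof (cases "0 \<le> Im w")
    case False
    then show ?thesis using upper[of "cnj w"] w by (simp add: g_cnj)
  qed (use upper w in auto)
qed

text \<open>
  The imaginary part of the integrand converges boundedly for every \<open>\<theta> \<noteq> \<alpha>\<close>. With \<open>t = \<pi> N \<alpha>\<close> the two
  arguments \<open>(s \<mp> \<pi>) / 2\<close>, \<open>s = t - \<pi> N \<theta>\<close>, and \<open>(s' - \<pi>) / 2\<close>, \<open>s' = t + \<pi> N \<theta>\<close>, add up to \<open>t - \<pi>\<close> for
  \<open>\<theta> < \<alpha>\<close> and to \<open>t\<close> for \<open>\<theta> > \<alpha>\<close>: the dependence on \<open>N \<theta>\<close> cancels. Hence the limit is elementary.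
\<close>
lemma Im_q_limit:
  assumes \<alpha>: "0 < \<alpha>" "\<alpha> < pi" and r: "\<And>n::nat. 0 < r n \<and> r n < (1::real)" "r \<longlonglongrightarrow> 1"
  shows "(\<lambda>n. Im (q (of_real (r n) * cis (pi * N \<alpha>)))) \<longlonglongrightarrow> \<alpha> - pi * N \<alpha>"
proof -
  define t where "t = pi * N \<alpha>"
  define w where "w = (\<lambda>n. of_real (r n) * cis t)"
  define L where "L = (\<lambda>w \<theta>. Ln (1 - cnj (e \<theta>) * w) + Ln (1 - e \<theta> * w))"
  define f where "f = (\<lambda>n \<theta>. if \<theta> = \<alpha> then 0 else Im (L (w n) \<theta>))"
  define h where "h = (\<lambda>\<theta>. if \<theta> = \<alpha> then 0 else if \<theta> < \<alpha> then t - pi else t)"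
  have w: "cmod (w n) < 1" for n using r(1)[of n] by (simp add: w_def norm_mult)
  have NN: "N \<theta> < N \<theta>'" if "0 \<le> \<theta>" "\<theta> < \<theta>'" "\<theta>' \<le> pi" for \<theta> \<theta>'
    using strict_mono_onD[OF N_mono, of \<theta> \<theta>'] that by auto
  have N\<alpha>: "0 < t" "t < pi"
    using NN[of 0 \<alpha>] NN[of \<alpha> pi] \<alpha> by (auto simp: t_def N_0 N_pi)
  have intL: "((\<lambda>\<theta>. Im (L (w n) \<theta>)) has_integral - pi * Im (q (w n))) {0..pi}" for n
  proof -
    have "((\<lambda>\<theta>. Im (L (w n) \<theta>)) has_integral Im (integral {0..pi} (L (w n)))) {0..pi}"
      using has_integral_linear[OF integrable_integral[OF q_integrand_integrable[OF w[of n]]] bounded_linear_Im]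
      by (simp add: o_def L_def)
    moreover have "Im (integral {0..pi} (L (w n))) = - pi * Im (q (w n))"
      unfolding q_def L_def by (simp add: Im_divide_of_real)
    ultimately show ?thesis by simp
  qed
  have f: "(f n has_integral - pi * Im (q (w n))) {0..pi}" for n
    using has_integral_spike_finite[of "{\<alpha>}" "{0..pi}" "f n" "\<lambda>\<theta>. Im (L (w n) \<theta>)", OF _ _ intL]
    by (simp add: f_def)
  have h: "(h has_integral pi * t - pi * \<alpha>) {0..pi}"
  proof -
    have "(h has_integral \<alpha> * (t - pi)) {0..\<alpha>}"
      by (rule has_integral_spike_finite[of "{\<alpha>}", OF _ _ has_integral_const_real[of "t - pi" 0 \<alpha>, simplified content_real_if], THEN has_integral_eq_rhs])
        (use \<alpha> in \<open>auto simp: h_def\<close>)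
    moreover have "(h has_integral (pi - \<alpha>) * t) {\<alpha>..pi}"
      by (rule has_integral_spike_finite[of "{\<alpha>}", OF _ _ has_integral_const_real[of t \<alpha> pi, simplified content_real_if], THEN has_integral_eq_rhs])
        (use \<alpha> in \<open>auto simp: h_def\<close>)
    ultimately have "(h has_integral \<alpha> * (t - pi) + (pi - \<alpha>) * t) {0..pi}"
      using \<alpha> by (intro has_integral_combine[of 0 \<alpha> pi]) auto
    then show ?thesis by (simp add: algebra_simps)
  qed
  have lim: "(\<lambda>n. f n \<theta>) \<longlonglongrightarrow> h \<theta>" if \<theta>: "\<theta> \<in> {0..pi}" for \<theta>
  proof (cases "\<theta> = \<alpha>")
    case False
    define s where "s = t - pi * N \<theta>"
    define s' where "s' = t + pi * N \<theta>"
    have cw: "cnj (e \<theta>) * w n = of_real (r n) * cis s" "e \<theta> * w n = of_real (r n) * cis s'" for n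
      by (simp_all add: e_def w_def s_def s'_def cis_cnj cis_mult add.commute)
    have N01: "0 \<le> pi * N \<theta>" "pi * N \<theta> \<le> pi" using N_range[OF \<theta>] by auto
    have ne: "1 - cis x \<notin> \<real>\<^sub>\<le>\<^sub>0" if "0 < \<bar>x\<bar>" "\<bar>x\<bar> < 2 * pi" for x
    proof
      assume "1 - cis x \<in> \<real>\<^sub>\<le>\<^sub>0"
      then have "1 \<le> cos x" by (auto simp: complex_nonpos_Reals_iff)
      moreover have "cos \<bar>x\<bar> = 1 - 2 * (sin (\<bar>x\<bar> / 2))\<^sup>2" using cos_double_sin[of "\<bar>x\<bar> / 2"] by simp
      moreover have "0 < sin (\<bar>x\<bar> / 2)" using that by (intro sin_gt_zero) auto
      ultimately show False by (simp add: not_less[symmetric])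
    qed
    have lim1: "(\<lambda>n. Im (Ln (1 - of_real (r n) * cis x))) \<longlonglongrightarrow> Im (Ln (1 - cis x))"
      if "0 < \<bar>x\<bar>" "\<bar>x\<bar> < 2 * pi" for x
    proof -
      have "(\<lambda>n. 1 - of_real (r n) * cis x) \<longlonglongrightarrow> 1 - of_real 1 * cis x"
        by (intro tendsto_intros r)
      then show ?thesis using ne[OF that] by (intro tendsto_Im tendsto_Ln) auto
    qed
    have s': "0 < s'" "s' < 2 * pi" using N\<alpha> N01 unfolding s'_def by linarith+
    have sb: "\<bar>s\<bar> < pi" using N\<alpha> N01 unfolding s_def by linarith
    have hs: "0 < \<bar>s\<bar> \<and> Im (Ln (1 - cis s)) + Im (Ln (1 - cis s')) = h \<theta>"
    proof (cases "\<theta> < \<alpha>")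
      case True
      then have "0 < s" using NN[of \<theta> \<alpha>] \<theta> \<alpha> by (simp add: s_def t_def)
      then have "Im (Ln (1 - cis s)) = (s - pi) / 2" using sb by (intro Im_Ln_one_minus_cis) auto
      then show ?thesis using Im_Ln_one_minus_cis[OF s'] \<open>0 < s\<close> True
        by (simp add: h_def s_def s'_def field_simps)
    next
      case F: False
      then have "s < 0" using NN[of \<alpha> \<theta>] \<theta> \<alpha> False by (simp add: s_def t_def)
      then have "Im (Ln (1 - cis s)) = (s + pi) / 2" using sb by (intro Im_Ln_one_minus_cis_neg) auto
      then show ?thesis using Im_Ln_one_minus_cis[OF s'] \<open>s < 0\<close> F False
        by (simp add: h_def s_def s'_def field_simps)
    qed
    have "(\<lambda>n. Im (Ln (1 - of_real (r n) * cis s)) + Im (Ln (1 - of_real (r n) * cis s'))) \<longlonglongrightarrow>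
        Im (Ln (1 - cis s)) + Im (Ln (1 - cis s'))"
      using hs s' sb by (intro tendsto_add lim1) auto
    then show ?thesis using hs False by (simp add: f_def L_def cw)
  qed (simp add: f_def h_def)
  have bd: "norm (f n \<theta>) \<le> 2 * pi" for n \<theta>
  proof -
    have *: "\<bar>Im (Ln z)\<bar> \<le> pi" if "z \<noteq> 0" for z
      using mpi_less_Im_Ln[OF that] Im_Ln_le_pi[OF that] by simp
    have "1 - cnj (e \<theta>) * w n \<noteq> 0" "1 - e \<theta> * w n \<noteq> 0"
      by (rule one_minus_notin_nonpos; simp add: norm_mult w)+
    from *[OF this(1)] *[OF this(2)] show ?thesis by (auto simp: f_def L_def)
  qed
  have "(\<lambda>n. integral {0..pi} (f n)) \<longlonglongrightarrow> integral {0..pi} h"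
    by (rule dominated_convergence(2)[where h = "\<lambda>_. 2 * pi"]) (use f lim bd in auto)
  then have "(\<lambda>n. - pi * Im (q (w n))) \<longlonglongrightarrow> pi * t - pi * \<alpha>"
    unfolding integral_unique[OF f] integral_unique[OF h] .
  from tendsto_mult_left[OF this, of "- 1 / pi"]
  have "(\<lambda>n. Im (q (w n))) \<longlonglongrightarrow> - 1 / pi * (pi * t - pi * \<alpha>)" by simp
  moreover have "- 1 / pi * (pi * t - pi * \<alpha>) = \<alpha> - t" by (simp add: diff_divide_distrib)
  ultimately show ?thesis by (simp add: w_def t_def)
qed

lemma sgn_g_limit:
  assumes \<alpha>: "0 < \<alpha>" "\<alpha> < pi" and r: "\<And>n::nat. 0 < r n \<and> r n < (1::real)" "r \<longlonglongrightarrow> 1"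
  shows "(\<lambda>n. sgn (g (of_real (r n) * cis (pi * N \<alpha>)))) \<longlonglongrightarrow> cis \<alpha>"
proof -
  have "(\<lambda>n. cis (pi * N \<alpha>) * cis (Im (q (of_real (r n) * cis (pi * N \<alpha>))))) \<longlonglongrightarrow>
      cis (pi * N \<alpha>) * cis (\<alpha> - pi * N \<alpha>)"
    by (intro tendsto_mult tendsto_const tendsto_cis Im_q_limit assms)
  moreover have "sgn (g (of_real (r n) * cis t)) = cis t * cis (Im (q (of_real (r n) * cis t)))" for n t
    unfolding g_def sgn_mult using r(1)[of n] by (simp add: exp_eq_polar sgn_mult sgn_of_real)
  ultimately show ?thesis by (simp add: cis_mult)
qed

end

section \<open>Extension of the positive part by zero\<close>

text \<open>
  The values are real since a subharmonic function is below \<open>\<infinity>\<close>; the cut at \<open>0\<close> removes \<open>- \<infinity>\<close>.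
\<close>
definition pos_part_ext :: "(complex \<Rightarrow> ereal) \<Rightarrow> complex \<Rightarrow> real" where
  "pos_part_ext u z = (if 0 < Im z then real_of_ereal (max (u z) 0) else 0)"

lemma pos_part_ext_nonneg: "0 \<le> pos_part_ext u z"
  by (simp add: pos_part_ext_def real_of_ereal_pos)

lemma ereal_pos_part_ext:
  assumes "subharmonic_on upper_half_plane u" "0 < Im z"
  shows "ereal (pos_part_ext u z) = max (u z) 0"
proof -
  have "u z < \<infinity>" using assms unfolding subharmonic_on_def upper_half_plane_def by blast
  then show ?thesis using assms(2) by (cases "u z") (auto simp: pos_part_ext_def max_def)
qed

lemma ennreal_pos_part_ext:
  assumes "subharmonic_on upper_half_plane u" "0 < Im z"
  shows "ennreal (pos_part_ext u z) = e2ennreal (max (u z) 0)"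
  using arg_cong[OF ereal_pos_part_ext[OF assms], of e2ennreal] by simp

text \<open>The boundary condition on the upper limit is exactly upper semicontinuity of the extension on the real axis.\<close>
lemma pos_part_ext_usc:
  assumes u: "subharmonic_on upper_half_plane u"
    and bd: "\<forall>x0::real. Limsup (at (complex_of_real x0) within upper_half_plane) u \<le> 0"
  shows "usc_on UNIV (pos_part_ext u)"
proof (rule usc_onI_ball)
  fix x c assume c: "pos_part_ext u x < c"
  then have c0: "0 < c" using pos_part_ext_nonneg[of u x] by linarith
  have less: "pos_part_ext u y < c" if "0 < Im y \<Longrightarrow> u y < ereal c" for y
  proof (cases "0 < Im y")
    case True
    then have "ereal (pos_part_ext u y) < ereal c" using that c0 by (simp add: ereal_pos_part_ext[OF u])
    then show ?thesis by simp
  qed (simp add: pos_part_ext_def c0)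
  consider "0 < Im x" | "Im x < 0" | "Im x = 0" by linarith
  then show "\<exists>d>0. \<forall>y\<in>UNIV. dist y x < d \<longrightarrow> pos_part_ext u y < c"
  proof cases
    case 1
    have "ereal (pos_part_ext u x) < ereal c" using c by simp
    then have "u x < ereal c" using ereal_pos_part_ext[OF u 1] by simp
    moreover have "open {z \<in> upper_half_plane. u z < ereal c}" using u by (simp add: subharmonic_on_def)
    ultimately obtain d where d: "d > 0" "ball x d \<subseteq> {z \<in> upper_half_plane. u z < ereal c}"
      using 1 unfolding open_contains_ball upper_half_plane_def by blast
    then show ?thesis by (intro exI[of _ d]) (auto intro!: less simp: dist_commute subset_iff)
  next
    case 2
    have "Im y \<le> 0" if "dist y x < - Im x" for y
      using abs_Im_le_cmod[of "y - x"] that by (simp add: dist_norm)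
    then show ?thesis using 2 by (intro exI[of _ "- Im x"]) (auto intro!: less, fastforce)
  next
    case 3
    then have x: "x = complex_of_real (Re x)" by (simp add: complex_eq_iff)
    have "Limsup (at x within upper_half_plane) u < ereal c"
      using bd c0 by (subst x) (metis ereal_less(2) order_le_less_trans)
    then have "\<forall>\<^sub>F y in at x within upper_half_plane. u y < ereal c" by (rule Limsup_lessD)
    then obtain d where d: "d > 0" "\<And>y. y \<in> upper_half_plane \<Longrightarrow> y \<noteq> x \<Longrightarrow> dist y x < d \<Longrightarrow> u y < ereal c"
      unfolding eventually_at by blast
    show ?thesis
    proof (intro exI[of _ d] conjI d(1) ballI impI)
      fix y assume y: "dist y x < d"
      show "pos_part_ext u y < c"
      proof (rule less)
        assume "0 < Im y"
        then show "u y < ereal c" using 3 y by (intro d(2)) (auto simp: upper_half_plane_def)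
      qed
    qed
  qed
qed

lemma pos_part_ext_submean:
  assumes u: "subharmonic_on upper_half_plane u" and r: "0 < r" "r < Im z"
  shows "ennreal (2 * pi * pos_part_ext u z) \<le>
    (\<integral>\<^sup>+\<theta>\<in>{0..2 * pi}. ennreal (pos_part_ext u (z + of_real r * cis \<theta>)) \<partial>lborel)"
proof (cases "pos_part_ext u z = 0")
  case False
  then have pos: "0 < pos_part_ext u z" using pos_part_ext_nonneg[of u z] by linarith
  have Imz: "0 < Im z" using r by simp
  have uz: "u z = ereal (pos_part_ext u z)"
    using ereal_pos_part_ext[OF u Imz] pos by (auto simp: max_def split: if_splits)
  have Im_pos: "0 < Im (z + of_real r * cis \<theta>)" for \<theta>
  proof -
    have "\<bar>r * sin \<theta>\<bar> \<le> r" using r by (simp add: abs_mult mult_left_le)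
    then show ?thesis using r by simp
  qed
  define I where "I = (\<integral>\<^sup>+\<theta>\<in>{0..2 * pi}. ennreal (pos_part_ext u (z + of_real r * cis \<theta>)) \<partial>lborel)"
  define J where "J = (\<integral>\<^sup>+\<theta>\<in>{0..2 * pi}. e2ennreal (- u (z + of_real r * cis \<theta>)) \<partial>lborel)"
  have e2: "e2ennreal (u (z + of_real r * cis \<theta>)) = ennreal (pos_part_ext u (z + of_real r * cis \<theta>))" for \<theta>
    unfolding ennreal_pos_part_ext[OF u Im_pos] by (auto simp: max_def e2ennreal_neg)
  have "cball z r \<subseteq> upper_half_plane"
  proof
    fix y assume "y \<in> cball z r"
    then have "\<bar>Im (z - y)\<bar> \<le> r" using abs_Im_le_cmod[of "z - y"] by (simp add: dist_norm)
    then show "y \<in> upper_half_plane" using r by (simp add: upper_half_plane_def)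
  qed
  then have "u z \<le> circle_mean u z r" using u r by (simp add: subharmonic_on_def)
  then have le: "ereal (pos_part_ext u z) \<le> (enn2ereal I - enn2ereal J) / ereal (2 * pi)"
    unfolding circle_mean_def e2 uz[symmetric] I_def J_def .
  have "ennreal (2 * pi * pos_part_ext u z) \<le> I"
  proof (cases I)
    case (real i)
    show ?thesis
    proof (cases J)
      case (real j)
      then have "pos_part_ext u z \<le> (i - j) / (2 * pi)" using le \<open>I = ennreal i\<close> \<open>0 \<le> i\<close> by (simp add: enn2ereal_ennreal)
      then have "2 * pi * pos_part_ext u z \<le> i - j" by (simp add: field_simps)
      then show ?thesis using real \<open>I = ennreal i\<close> by (auto intro!: ennreal_leI)
    next
      case top
      then show ?thesis using le \<open>I = ennreal i\<close> \<open>0 \<le> i\<close> by (simp add: enn2ereal_ennreal)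
    qed
  qed simp
  then show ?thesis unfolding I_def .
qed simp

lemma nn_subharmonic_pos_part_ext:
  assumes u: "subharmonic_on upper_half_plane u"
    and bd: "\<forall>x0::real. Limsup (at (complex_of_real x0) within upper_half_plane) u \<le> 0"
  shows "nn_subharmonic (pos_part_ext u)"
  unfolding nn_subharmonic_def
proof (intro conjI allI)
  fix z
  show "\<exists>\<rho>>0. \<forall>r. 0 < r \<and> r < \<rho> \<longrightarrow> ennreal (2 * pi * pos_part_ext u z) \<le>
      (\<integral>\<^sup>+\<theta>\<in>{0..2 * pi}. ennreal (pos_part_ext u (z + of_real r * cis \<theta>)) \<partial>lborel)"
  proof (cases "0 < Im z")
    case True
    then show ?thesis using pos_part_ext_submean[OF u] by blast
  next
    case False
    then show ?thesis by (intro exI[of _ 1]) (simp add: pos_part_ext_def)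
  qed
qed (rule pos_part_ext_nonneg pos_part_ext_usc[OF u bd])+

section \<open>Measures of class A\<close>

locale class_A_measure =
  fixes \<nu> :: "real measure"
  assumes \<nu>: "\<nu> \<in> class_A 0 pi"
begin

sublocale real_distribution \<nu> using \<nu> by (simp add: class_A_def)

abbreviation "N \<equiv> distr_fun 0 \<nu>"
abbreviation "\<mu> \<equiv> inv_distr_fun 0 pi \<nu>"

lemma N_pi': "N pi = 1" using \<nu> by (simp add: class_A_def distr_fun_def)

sublocale angular_profile N
  using \<nu> N_pi' by unfold_locales (simp_all add: class_A_def)

lemma N_mono_UNIV: "mono N"
  unfolding distr_fun_def by (intro monoI finite_measure_mono) auto

lemma N_borel [measurable]: "N \<in> borel_measurable borel"
  by (rule borel_measurable_mono[OF N_mono_UNIV])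

lemma N_less: "0 \<le> x \<Longrightarrow> x < y \<Longrightarrow> y \<le> pi \<Longrightarrow> N x < N y"
  using strict_mono_onD[OF N_mono, of x y] by auto

lemma N_outside: "x < 0 \<Longrightarrow> N x = 0" "pi < x \<Longrightarrow> N x = 1"
proof -
  show "N x = 0" if "x < 0" using that by (simp add: distr_fun_def)
  show "N x = 1" if "pi < x"
    using monoD[OF N_mono_UNIV, of pi x] that N_pi
    by (intro order_antisym) (simp_all add: distr_fun_def)
qed

lemma cdf_eq_N: "cdf \<nu> x = N x"
proof -
  have "prob {0..pi} = 1" using \<nu> by (simp add: class_A_def)
  then have ae: "AE y in \<nu>. y \<in> {0..pi}" by (simp add: prob_eq_1)
  show ?thesis unfolding cdf_def distr_fun_def
    by (rule finite_measure_eq_AE) (use ae in \<open>auto elim: eventually_mono\<close>)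
qed

lemma \<mu>_props: assumes "0 \<le> s" "s \<le> 1" shows "\<mu> s \<in> {0..pi}" "N (\<mu> s) = s"
proof -
  have inj: "inj_on N {0..pi}" using N_mono by (rule strict_mono_on_imp_inj_on)
  have "\<exists>x\<ge>0. x \<le> pi \<and> N x = s"
    using assms N_0 N_pi N_cont by (intro IVT') auto
  then have im: "s \<in> N ` {0..pi}" by auto
  have eq: "\<mu> s = the_inv_into {0..pi} N s" using assms by (simp add: inv_distr_fun_def)
  show "\<mu> s \<in> {0..pi}" unfolding eq by (rule the_inv_into_into[OF inj im]) simp
  show "N (\<mu> s) = s" unfolding eq by (rule f_the_inv_into_f[OF inj im])
qed

lemma \<mu>_range: "\<mu> s \<in> {0..pi}"
  using \<mu>_props(1)[of s] by (cases "s < 0"; cases "s > 1") (auto simp: inv_distr_fun_def)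

lemma \<mu>_interior: assumes "0 < s" "s < 1" shows "0 < \<mu> s" "\<mu> s < pi"
proof -
  have "\<mu> s \<noteq> 0" "\<mu> s \<noteq> pi" using \<mu>_props(2)[of s] assms N_0 N_pi by auto
  then show "0 < \<mu> s" "\<mu> s < pi" using \<mu>_range[of s] by auto
qed

lemma \<mu>_upper: assumes "\<theta> \<in> {0..pi}" "N \<theta> < s" shows "\<theta> \<le> \<mu> s"
proof (cases "s \<le> 1")
  case True
  have s: "0 \<le> s" using N_range[OF assms(1)] assms(2) by linarith
  show ?thesis
  proof (rule ccontr)
    assume "\<not> \<theta> \<le> \<mu> s"
    then have "N (\<mu> s) < N \<theta>" using \<mu>_range[of s] assms(1) by (intro N_less) auto
    then show False using \<mu>_props(2)[OF s True] assms(2) by simp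
  qed
next
  case False
  then show ?thesis using assms(1) by (simp add: inv_distr_fun_def)
qed

lemma \<mu>_lower: assumes "\<theta> \<in> {0..pi}" "s < N \<theta>" shows "\<mu> s \<le> \<theta>"
proof (cases "0 \<le> s")
  case True
  have s: "s \<le> 1" using N_range[OF assms(1)] assms(2) by linarith
  show ?thesis
  proof (rule ccontr)
    assume "\<not> \<mu> s \<le> \<theta>"
    then have "N \<theta> < N (\<mu> s)" using \<mu>_range[of s] assms(1) by (intro N_less) auto
    then show False using \<mu>_props(2)[OF True s] assms(2) by simp
  qed
next
  case False
  then show ?thesis using assms(1) by (simp add: inv_distr_fun_def)
qed

lemma mono_\<mu>: "mono \<mu>"
proof (rule monoI)
  fix s s' :: real assume "s \<le> s'"
  show "\<mu> s \<le> \<mu> s'"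
  proof (cases "s = s' \<or> s < 0 \<or> s' > 1")
    case True
    then show ?thesis using \<mu>_range[of s] \<mu>_range[of s'] by (auto simp: inv_distr_fun_def)
  next
    case False
    then have "s < N (\<mu> s')" using \<mu>_props(2)[of s'] \<open>s \<le> s'\<close> by simp
    then show ?thesis by (intro \<mu>_lower \<mu>_range)
  qed
qed

lemma \<mu>_borel [measurable]: "\<mu> \<in> borel_measurable borel"
  by (rule borel_measurable_mono[OF mono_\<mu>])

text \<open>
  The inverse distribution function pushes the uniform distribution forward to \<open>\<nu>\<close>: on \<open>(0,1)\<close> it is the
  generalised inverse of the cumulative distribution function.
\<close>
lemma nn_integral_\<nu>:
  assumes F[measurable]: "F \<in> borel_measurable borel"
  shows "(\<integral>\<^sup>+\<theta>. F \<theta> \<partial>\<nu>) = (\<integral>\<^sup>+x\<in>{0<..<1}. F (\<mu> x) \<partial>lborel)"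
proof -
  interpret C: cdf_distribution \<nu> by unfold_locales
  have I: "C.I \<omega> = \<mu> \<omega>" if \<omega>: "0 < \<omega>" "\<omega> < 1" for \<omega>
  proof (rule order_antisym)
    have *: "\<omega> \<le> cdf \<nu> x \<longleftrightarrow> C.I \<omega> \<le> x" for x using C.pseudoinverse[OF \<omega>] .
    show "C.I \<omega> \<le> \<mu> \<omega>" using *[of "\<mu> \<omega>"] \<mu>_props(2)[of \<omega>] \<omega> by (simp add: cdf_eq_N)
    have "\<omega> \<le> N (C.I \<omega>)" using *[of "C.I \<omega>"] by (simp add: cdf_eq_N)
    then show "\<mu> \<omega> \<le> C.I \<omega>"
    proof (cases "C.I \<omega> < 0 \<or> pi < C.I \<omega>")
      case True
      then show ?thesis using \<open>\<omega> \<le> N (C.I \<omega>)\<close> N_outside[of "C.I \<omega>"] \<omega> \<mu>_range[of \<omega>] by auto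
    next
      case False
      show ?thesis
      proof (rule ccontr)
        assume "\<not> \<mu> \<omega> \<le> C.I \<omega>"
        then have "N (C.I \<omega>) < N (\<mu> \<omega>)" using False \<mu>_range[of \<omega>] by (intro N_less) auto
        then show False using \<open>\<omega> \<le> N (C.I \<omega>)\<close> \<mu>_props(2)[of \<omega>] \<omega> by simp
      qed
    qed
  qed
  have [measurable]: "C.I \<in> borel_measurable (restrict_space lborel {0<..<1})"
    using C.measurable_CI by (simp add: measurable_cong_sets sets_restrict_space)
  have "(\<integral>\<^sup>+\<theta>. F \<theta> \<partial>\<nu>) = (\<integral>\<^sup>+\<theta>. F \<theta> \<partial>distr (restrict_space lborel {0<..<1}) borel C.I)"
    by (simp only: C.distr_I_eq_M)
  also have "\<dots> = (\<integral>\<^sup>+x. F (C.I x) \<partial>restrict_space lborel {0<..<1})"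
    by (rule nn_integral_distr) measurable
  also have "\<dots> = (\<integral>\<^sup>+x\<in>{0<..<1}. F (C.I x) \<partial>lborel)"
    by (rule nn_integral_restrict_space) simp
  also have "\<dots> = (\<integral>\<^sup>+x\<in>{0<..<1}. F (\<mu> x) \<partial>lborel)"
    by (intro nn_integral_cong) (auto simp: I split: split_indicator)
  finally show ?thesis .
qed

text \<open>
  Class A enters the proof here. One \<open>\<delta>\<close> with a finite bound on the supremum suffices; the value \<open>1\<close> for
  that bound is an arbitrary choice.
\<close>
lemma norm_g_bounded:
  obtains C where "C \<ge> 1" "\<And>w. cmod w < 1 \<Longrightarrow> cmod (g w) \<le> C"
proof -
  have "((\<lambda>\<delta>. SUP x. \<integral>\<^sup>+ t \<in> {0<..<\<delta>}. ennreal ((\<mu> (x + t) - \<mu> (x - t)) / t) \<partial>lborel) \<longlongrightarrow> 0) (at_right 0)"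
    using \<nu> by (simp add: class_A_def)
  then have "\<forall>\<^sub>F \<delta> in at_right 0. (SUP x. \<integral>\<^sup>+ t \<in> {0<..<\<delta>}. ennreal ((\<mu> (x + t) - \<mu> (x - t)) / t) \<partial>lborel) < 1"
    by (rule order_tendstoD) simp
  then obtain b where b: "b > 0" "\<And>\<delta>. 0 < \<delta> \<Longrightarrow> \<delta> < b \<Longrightarrow>
      (SUP x. \<integral>\<^sup>+ t \<in> {0<..<\<delta>}. ennreal ((\<mu> (x + t) - \<mu> (x - t)) / t) \<partial>lborel) < 1"
    unfolding eventually_at_right_field by auto
  define \<delta> where "\<delta> = min b 1 / 2"
  have \<delta>: "0 < \<delta>" "\<delta> < 1" "\<delta> < b" using b(1) by (auto simp: \<delta>_def)
  have bound: "(\<integral>\<^sup>+ t \<in> {0<..<\<delta>}. ennreal ((\<mu> (x + t) - \<mu> (x - t)) / t) \<partial>lborel) \<le> ennreal 1" for x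
    using SUP_lessD[OF b(2)[OF \<delta>(1,3)], of x] by simp
  have le: "cmod (g w) \<le> cmod w * exp (2 * (pi * ln (1 / \<delta>) + 1) / pi)" if w: "cmod w < 1" for w
  proof (rule norm_g_le[OF _ w])
    fix k x assume k: "continuous_on {0..pi} k" "\<And>\<theta>. \<theta> \<in> {0..pi} \<Longrightarrow> 0 < k \<theta> \<and> \<bar>x - N \<theta>\<bar> \<le> k \<theta>"
    show "integral {0..pi} (\<lambda>\<theta>. - ln (k \<theta>)) \<le> pi * ln (1 / \<delta>) + 1"
      by (rule log_potential_bound[OF N_borel \<delta>(1,2) _ \<mu>_upper \<mu>_lower bound k(1)]) (use k(2) in auto)
  qed
  define K where "K = exp (2 * (pi * ln (1 / \<delta>) + 1) / pi)"
  have K: "0 < K" by (simp add: K_def)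
  show ?thesis
  proof (rule that)
    fix w :: complex assume w: "cmod w < 1"
    have "cmod (g w) \<le> cmod w * K" using le[OF w] by (simp only: K_def)
    also have "\<dots> \<le> 1 * K" using w K by (intro mult_right_mono) auto
    finally show "cmod (g w) \<le> max 1 K" by simp
  qed simp
qed

end

section \<open>Growth estimate from the weighted means\<close>

definition ray_integral :: "(complex \<Rightarrow> real) \<Rightarrow> real \<Rightarrow> real \<Rightarrow> complex \<Rightarrow> ennreal" where
  "ray_integral v a b d = (\<integral>\<^sup>+s\<in>{a..b}. ennreal (v (of_real s * d)) \<partial>lborel)"

lemma usc_on_subset: "usc_on UNIV v \<Longrightarrow> usc_on S v"
  using usc_on_compose[of UNIV v S id] by (simp add: continuous_on_id)

lemma ray_integral_le:
  assumes M: "\<And>z. cmod z \<le> b \<Longrightarrow> v z \<le> M" and d: "cmod d \<le> 1" and a: "0 \<le> a"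
  shows "ennreal (v (of_real s * d)) * indicator {a..b} s \<le> ennreal M * indicator {a..b} s"
proof (cases "s \<in> {a..b}")
  case True
  then have "cmod (of_real s * d) \<le> b * 1" unfolding norm_mult using d a by (intro mult_mono) auto
  then show ?thesis by (intro mult_right_mono ennreal_leI M) auto
qed simp

text \<open>
  By the reverse lemma of Fatou, upper semicontinuity in the plane passes to integrals along rays as
  functions of the direction.
\<close>
lemma limsup_ray_integral:
  assumes v: "usc_on UNIV v" and X: "X \<longlonglongrightarrow> d" "\<And>n::nat. cmod (X n) \<le> 1" and a: "0 \<le> a"
  shows "limsup (\<lambda>n. ray_integral v a b (X n)) \<le> ray_integral v a b d"
proof -
  obtain M where M: "\<And>z. cmod z \<le> b \<Longrightarrow> v z \<le> M"
    using usc_on_bounded_above[OF compact_cball[of 0 b] usc_on_subset[OF v]] by auto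
  have [measurable]: "v \<in> borel_measurable borel" by (rule usc_on_borel_measurable[OF v])
  have "limsup (\<lambda>n. ray_integral v a b (X n)) \<le>
      (\<integral>\<^sup>+s. limsup (\<lambda>n. ennreal (v (of_real s * X n)) * indicator {a..b} s) \<partial>lborel)"
    unfolding ray_integral_def
  proof (rule nn_integral_limsup[where w = "\<lambda>s. ennreal M * indicator {a..b} s"])
    show "AE s in lborel. ennreal (v (of_real s * X n)) * indicator {a..b} s \<le> ennreal M * indicator {a..b} s" for n
      by (intro AE_I2 ray_integral_le M X(2) a)
    show "(\<integral>\<^sup>+s. ennreal M * indicator {a..b} s \<partial>lborel) < \<infinity>"
      by (simp add: nn_integral_cmult_indicator ennreal_mult_less_top emeasure_lborel_Icc_eq)
  qed measurable
  also have "\<dots> \<le> ray_integral v a b d"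
    unfolding ray_integral_def
  proof (rule nn_integral_mono)
    fix s
    show "limsup (\<lambda>n. ennreal (v (of_real s * X n)) * indicator {a..b} s) \<le> ennreal (v (of_real s * d)) * indicator {a..b} s"
      using usc_limsup_ennreal[OF v tendsto_mult_left[OF X(1), of "of_real s"]]
      by (cases "s \<in> {a..b}") (auto simp: Limsup_const)
  qed
  finally show ?thesis .
qed

text \<open>
  The substitution \<open>s = \<rho> \<bar>\<gamma>\<bar>\<close> costs the factor \<open>1 / \<bar>\<gamma>\<bar> \<le> 8\<close> and leaves only the direction of \<open>\<gamma>\<close>.
\<close>
lemma radial_average_le_ray_integral:
  assumes [measurable]: "v \<in> borel_measurable borel" and \<gamma>: "1 / 8 \<le> cmod \<gamma>" "cmod \<gamma> \<le> C" and R: "R > 0"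
  shows "(\<integral>\<^sup>+\<rho>\<in>{R..2 * R}. ennreal (v (of_real \<rho> * \<gamma>)) \<partial>lborel) \<le> 8 * ray_integral v (R / 8) (2 * C * R) (sgn \<gamma>)"
    (is "?I \<le> _")
proof -
  define f where "f = (\<lambda>s. ennreal (v (of_real s * sgn \<gamma>)) * indicator {R..2 * R} (s / cmod \<gamma>))"
  have [measurable]: "f \<in> borel_measurable borel" unfolding f_def by measurable
  have \<gamma>0: "0 < cmod \<gamma>" using \<gamma> by linarith
  have sg: "of_real (cmod \<gamma>) * sgn \<gamma> = \<gamma>" using \<gamma>0 by (simp add: sgn_div_norm scaleR_conv_of_real)
  have "of_real (0 + cmod \<gamma> * x) * sgn \<gamma> = of_real x * \<gamma>" for x
    using sg by (metis add_0 mult.assoc mult.commute of_real_mult)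
  moreover have "(0 + cmod \<gamma> * x) / cmod \<gamma> = x" for x using \<gamma>0 by simp
  ultimately have f1: "f (0 + cmod \<gamma> * x) = ennreal (v (of_real x * \<gamma>)) * indicator {R..2 * R} x" for x
    unfolding f_def by presburger
  have "(\<integral>\<^sup>+s. f s \<partial>lborel) = ennreal (cmod \<gamma>) * ?I"
    using nn_integral_real_affine[of f "cmod \<gamma>" 0] \<gamma>0 unfolding f1 by simp
  moreover have "1 * ?I \<le> ennreal (8 * cmod \<gamma>) * ?I"
    using \<gamma> by (intro mult_right_mono) auto
  ultimately have "?I \<le> 8 * (\<integral>\<^sup>+s. f s \<partial>lborel)"
    by (simp add: ennreal_mult' mult.assoc)
  also have "(\<integral>\<^sup>+s. f s \<partial>lborel) \<le> ray_integral v (R / 8) (2 * C * R) (sgn \<gamma>)"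
    unfolding ray_integral_def
  proof (rule nn_integral_mono)
    fix s
    have "s \<in> {R / 8..2 * C * R}" if "s / cmod \<gamma> \<in> {R..2 * R}"
    proof -
      have "R * cmod \<gamma> \<le> s" "s \<le> 2 * R * cmod \<gamma>" using that \<gamma>0 by (auto simp: field_simps)
      moreover have "R * (1 / 8) \<le> R * cmod \<gamma>" "2 * R * cmod \<gamma> \<le> 2 * R * C" using \<gamma> R by (auto intro!: mult_left_mono)
      ultimately show ?thesis by (simp add: mult.commute mult.left_commute)
    qed
    then show "f s \<le> ennreal (v (of_real s * sgn \<gamma>)) * indicator {R / 8..2 * C * R} s"
      unfolding f_def by (auto split: split_indicator)
  qed
  finally show ?thesis by (simp add: mult_left_mono)
qed

context class_A_measure
begin

text \<open>
  Because \<open>g\<close> covers the disc of radius \<open>c\<close>, the fixed point \<open>z\<close> is \<open>\<rho> g w\<^sub>0\<close> with \<open>\<bar>w\<^sub>0\<bar> < 1/4 \<le> r/2\<close> for each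
  \<open>\<rho>\<close> in \<open>[R, 2R]\<close>, so the circle estimate holds for \<open>z\<close> with every dilation and can be averaged. The
  constant is \<open>2 \<pi> / 24\<close>, with \<open>24 = 3 \<cdot> 8\<close> from the inequality of Harnack and from
  \<open>\<bar>g\<bar> \<ge> r/4 \<ge> 1/8\<close>.
\<close>
lemma averaged_circle_estimate:
  assumes v: "nn_subharmonic v" and R: "R > 0" and r: "1 / 2 \<le> r" "r < 1"
    and C: "\<And>w. cmod w < 1 \<Longrightarrow> cmod (g w) \<le> C"
    and c: "ball 0 c \<subseteq> g ` ball 0 (1/4)" and z: "cmod z < c * R"
  shows "ennreal (pi * R * v z / 12) \<le>
    (\<integral>\<^sup>+t\<in>{0..2 * pi}. ray_integral v (R / 8) (2 * C * R) (sgn (g (of_real r * cis t))) \<partial>lborel)"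
proof -
  define \<gamma> where "\<gamma> = (\<lambda>t. g (of_real r * cis t))"
  have v0: "0 \<le> v y" for y using v by (simp add: nn_subharmonic_def)
  have [measurable]: "v \<in> borel_measurable borel"
    using v by (intro usc_on_borel_measurable) (simp add: nn_subharmonic_def)
  have "continuous_on UNIV \<gamma>" unfolding \<gamma>_def
    by (rule continuous_on_compose2[OF holomorphic_on_imp_continuous_on[OF g_holomorphic]])
      (use r in \<open>auto intro!: continuous_intros simp: norm_mult\<close>)
  then have [measurable]: "\<gamma> \<in> borel_measurable borel" by (rule borel_measurable_continuous_onI)
  have \<gamma>: "1 / 8 \<le> cmod (\<gamma> t)" "cmod (\<gamma> t) \<le> C" for t
  proof -
    have w: "cmod (of_real r * cis t) = r" using r by (simp add: norm_mult)
    show "1 / 8 \<le> cmod (\<gamma> t)" using norm_g_ge[of "of_real r * cis t"] r unfolding \<gamma>_def w by linarith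
    show "cmod (\<gamma> t) \<le> C" using r unfolding \<gamma>_def by (intro C) (simp only: w)
  qed
  have circle: "ennreal (2 * pi * v z) \<le> 3 * (\<integral>\<^sup>+t\<in>{0..2 * pi}. ennreal (v (of_real \<rho> * \<gamma> t)) \<partial>lborel)"
    if \<rho>: "\<rho> \<in> {R..2 * R}" for \<rho>
  proof -
    have \<rho>0: "\<rho> > 0" using \<rho> R by auto
    have "c > 0" using z R by (metis norm_ge_zero order_le_less_trans zero_less_mult_pos2)
    then have "c * R \<le> c * \<rho>" using \<rho> by (intro mult_left_mono) auto
    then have "cmod z < c * \<rho>" using z by linarith
    then have "z / of_real \<rho> \<in> ball 0 c" using \<rho>0 by (simp add: norm_divide field_simps)
    then have "z / of_real \<rho> \<in> g ` ball 0 (1/4)" using c by blast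
    then obtain w0 where w0: "cmod w0 < 1 / 4" "g w0 = z / of_real \<rho>" by (metis imageE mem_ball_0)
    define G where "G = (\<lambda>w. of_real \<rho> * g (of_real r * w))"
    have "(g \<circ> (\<lambda>w. of_real r * w)) holomorphic_on ball 0 (1 / r)"
    proof (rule holomorphic_on_compose_gen[OF _ g_holomorphic])
      show "(\<lambda>w. complex_of_real r * w) holomorphic_on ball 0 (1 / r)" by (intro holomorphic_intros)
      show "(\<lambda>w. complex_of_real r * w) ` ball 0 (1 / r) \<subseteq> ball 0 1"
        using r by (auto simp: norm_mult field_simps)
    qed
    then have G: "G holomorphic_on ball 0 (1 / r)"
      unfolding G_def o_def by (intro holomorphic_on_mult holomorphic_on_const)
    have dG: "deriv G w \<noteq> 0" if w: "cmod w < 1" for w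
    proof -
      have "r * cmod w \<le> 1 * cmod w" using r by (intro mult_right_mono) auto
      then have "r * cmod w < 1" using w by linarith
      then have "cmod (of_real r * w) < 1" using r by (simp add: norm_mult)
      then obtain d where d: "(g has_field_derivative d) (at (of_real r * w))" "d \<noteq> 0"
        by (rule g_has_field_derivative)
      have "((\<lambda>w. of_real r * w) has_field_derivative of_real r) (at w)" by (auto intro!: derivative_eq_intros)
      from DERIV_cmult[OF DERIV_chain2[OF d(1) this], of "of_real \<rho>"]
      have "deriv G w = of_real \<rho> * (d * of_real r)" unfolding G_def by (rule DERIV_imp_deriv)
      then show ?thesis using d(2) \<rho>0 r by simp
    qed
    have "ennreal (2 * pi * v (G (w0 / of_real r))) \<le> 3 * (\<integral>\<^sup>+t\<in>{0..2 * pi}. ennreal (v (G (cis t))) \<partial>lborel)"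
      by (rule subharmonic_le_circle_integral[OF v G _ dG]) (use r w0(1) in \<open>auto simp: norm_divide field_simps\<close>)
    moreover have "G (w0 / of_real r) = z" using r \<rho>0 by (simp add: G_def w0)
    ultimately show ?thesis by (simp add: G_def \<gamma>_def)
  qed
  have meas: "(\<lambda>t. ray_integral v (R / 8) (2 * C * R) (sgn (\<gamma> t)) * indicator {0..2 * pi} t) \<in> borel_measurable lborel"
    unfolding ray_integral_def sgn_div_norm by measurable
  have "24 * ennreal (pi * R * v z / 12) = ennreal (2 * pi * v z) * ennreal R"
    using v0[of z] R by (simp add: ennreal_mult'[symmetric] mult_ac flip: ennreal_numeral)
  also have "\<dots> = (\<integral>\<^sup>+\<rho>. ennreal (2 * pi * v z) * indicator {R..2 * R} \<rho> \<partial>lborel)"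
    using R by (subst nn_integral_cmult_indicator) (auto simp: emeasure_lborel_Icc_eq)
  also have "\<dots> \<le> (\<integral>\<^sup>+\<rho>. 3 * (\<integral>\<^sup>+t. ennreal (v (of_real \<rho> * \<gamma> t)) * indicator {0..2 * pi} t * indicator {R..2 * R} \<rho> \<partial>lborel) \<partial>lborel)"
    by (intro nn_integral_mono) (use circle in \<open>auto split: split_indicator\<close>)
  also have "\<dots> = 3 * (\<integral>\<^sup>+\<rho>. \<integral>\<^sup>+t. ennreal (v (of_real \<rho> * \<gamma> t)) * indicator {0..2 * pi} t * indicator {R..2 * R} \<rho> \<partial>lborel \<partial>lborel)"
    by (rule nn_integral_cmult) measurable
  also have "\<dots> = 3 * (\<integral>\<^sup>+t. \<integral>\<^sup>+\<rho>. ennreal (v (of_real \<rho> * \<gamma> t)) * indicator {0..2 * pi} t * indicator {R..2 * R} \<rho> \<partial>lborel \<partial>lborel)"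
    by (subst lborel_pair.Fubini') simp_all
  also have "\<dots> \<le> 3 * (\<integral>\<^sup>+t. 8 * (ray_integral v (R / 8) (2 * C * R) (sgn (\<gamma> t)) * indicator {0..2 * pi} t) \<partial>lborel)"
  proof (intro mult_left_mono nn_integral_mono)
    fix t
    show "(\<integral>\<^sup>+\<rho>. ennreal (v (of_real \<rho> * \<gamma> t)) * indicator {0..2 * pi} t * indicator {R..2 * R} \<rho> \<partial>lborel) \<le>
        8 * (ray_integral v (R / 8) (2 * C * R) (sgn (\<gamma> t)) * indicator {0..2 * pi} t)"
      using radial_average_le_ray_integral[of v "\<gamma> t" C R] \<gamma> R by (auto split: split_indicator)
  qed simp
  also have "\<dots> = 24 * (\<integral>\<^sup>+t\<in>{0..2 * pi}. ray_integral v (R / 8) (2 * C * R) (sgn (\<gamma> t)) \<partial>lborel)"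
    by (subst nn_integral_cmult[OF meas]) (subst mult.assoc[symmetric], simp)
  finally show ?thesis unfolding \<gamma>_def by (subst (asm) ennreal_mult_le_mult_iff) auto
qed

text \<open>
  As \<open>r\<close> tends to \<open>1\<close> the direction of \<open>g (r e\<^sup>i\<^sup>t)\<close> tends to that of \<open>e\<^sup>i\<^sup>\<mu>\<^sup>(\<^sup>t\<^sup>/\<^sup>\<pi>\<^sup>)\<close> for \<open>0 < t < \<pi>\<close> and into the
  closed lower half-plane, where \<open>v = 0\<close>, for \<open>\<pi> < t < 2 \<pi>\<close>. Semicontinuity bounds the upper limit of the
  estimates, and the image of \<open>dt\<close> under \<open>t \<mapsto> \<mu> (t/\<pi>)\<close> is \<open>\<pi> \<nu>\<close>. Only directions enter the limit
  because the modulus of \<open>g\<close> has been averaged out before.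
\<close>
lemma subharmonic_le_averaged_\<nu>_integral:
  assumes v: "nn_subharmonic v" and low: "\<And>z. Im z \<le> 0 \<Longrightarrow> v z = 0" and R: "R > 0"
    and C: "\<And>w. cmod w < 1 \<Longrightarrow> cmod (g w) \<le> C"
    and c: "ball 0 c \<subseteq> g ` ball 0 (1/4)" and z: "cmod z < c * R"
  shows "ennreal (pi * R * v z / 12) \<le>
    (\<integral>\<^sup>+s\<in>{R / 8..2 * C * R}. ennreal pi * (\<integral>\<^sup>+\<theta>\<in>{0<..<pi}. ennreal (v (of_real s * cis \<theta>)) \<partial>\<nu>) \<partial>lborel)"
proof -
  define V where "V = ray_integral v (R / 8) (2 * C * R)"
  have usc: "usc_on UNIV v" using v by (simp add: nn_subharmonic_def)
  have [measurable]: "v \<in> borel_measurable borel" by (rule usc_on_borel_measurable[OF usc])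
  have cis_borel [measurable]: "cis \<in> borel_measurable borel"
    by (intro borel_measurable_continuous_onI continuous_intros)
  define r where "r = (\<lambda>n::nat. 1 - 1 / (real n + 2))"
  have r: "1 / 2 \<le> r n" "r n < 1" for n by (auto simp: r_def field_simps)
  then have r01: "0 < r n \<and> r n < 1" for n using r(1)[of n] r(2)[of n] by linarith
  have r_lim: "r \<longlonglongrightarrow> 1" unfolding r_def by real_asymp
  have V0: "V d = 0" if "Im d \<le> 0" for d
  proof -
    have "ennreal (v (of_real s * d)) * indicator {R / 8..2 * C * R} s = 0" for s
    proof (cases "s \<in> {R / 8..2 * C * R}")
      case True
      then have "0 \<le> s" using R by simp
      then have "Im (of_real s * d) \<le> 0" using that by (simp add: mult_nonneg_nonpos)
      then show ?thesis using low by simp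
    qed simp
    then show ?thesis unfolding V_def ray_integral_def by (simp only: nn_integral_const) simp
  qed
  have norm_sgn_le: "cmod (sgn d) \<le> 1" for d by (simp add: norm_sgn)
  have lim: "limsup (\<lambda>n. V (sgn (g (of_real (r n) * cis t)))) \<le> V (cis (\<mu> (t / pi))) * indicator {0<..<pi} t"
    if t: "t \<in> {0..2 * pi}" "t \<noteq> 0" "t \<noteq> pi" "t \<noteq> 2 * pi" for t
  proof -
    have conv: "(\<lambda>n. sgn (g (of_real (r n) * cis s))) \<longlonglongrightarrow> cis (\<mu> (s / pi))" if s: "0 < s" "s < pi" for s
    proof -
      have "0 < s / pi" "s / pi < 1" using s by auto
      then show ?thesis using sgn_g_limit[OF \<mu>_interior r01 r_lim, of "s / pi"] \<mu>_props(2)[of "s / pi"] by simp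
    qed
    show ?thesis
    proof (cases "t < pi")
      case True
      then show ?thesis
        using limsup_ray_integral[OF usc conv norm_sgn_le, of t] t R unfolding V_def by simp
    next
      case False
      define s where "s = 2 * pi - t"
      have s: "0 < s" "s < pi" using False t by (auto simp: s_def)
      have "cis t = cnj (cis s)" by (simp add: s_def complex_eq_iff cos_diff sin_diff)
      then have "g (of_real (r n) * cis t) = cnj (g (of_real (r n) * cis s))" for n
        using g_cnj[of "of_real (r n) * cis s"] r01[of n] by (simp add: norm_mult)
      then have "sgn (g (of_real (r n) * cis t)) = cnj (sgn (g (of_real (r n) * cis s)))" for n
        by (simp add: sgn_div_norm)
      then have "(\<lambda>n. sgn (g (of_real (r n) * cis t))) \<longlonglongrightarrow> cnj (cis (\<mu> (s / pi)))"
        using tendsto_cnj[OF conv[OF s]] by simp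
      from limsup_ray_integral[OF usc this norm_sgn_le]
      have "limsup (\<lambda>n. V (sgn (g (of_real (r n) * cis t)))) \<le> V (cnj (cis (\<mu> (s / pi))))"
        unfolding V_def using R by simp
      also have "\<dots> = 0" using \<mu>_range[of "s / pi"] by (intro V0) (auto intro!: sin_ge_zero)
      finally show ?thesis by simp
    qed
  qed
  obtain M where M: "\<And>z. cmod z \<le> 2 * C * R \<Longrightarrow> v z \<le> M"
    using usc_on_bounded_above[OF compact_cball[of 0 "2 * C * R"] usc_on_subset[OF usc]] by auto
  define B where "B = ennreal M * emeasure lborel {R / 8..2 * C * R}"
  have B_top: "B < \<top>" unfolding B_def by (simp add: ennreal_mult_less_top emeasure_lborel_Icc_eq)
  have V_le: "V (sgn d) \<le> B" for d
  proof -
    have "V (sgn d) \<le> (\<integral>\<^sup>+s. ennreal M * indicator {R / 8..2 * C * R} s \<partial>lborel)"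
      unfolding V_def ray_integral_def using R by (intro nn_integral_mono ray_integral_le M norm_sgn_le) auto
    then show ?thesis by (simp add: B_def nn_integral_cmult_indicator)
  qed
  define U where "U = (\<lambda>n t. V (sgn (g (of_real (r n) * cis t))) * indicator {0..2 * pi} t)"
  have U_borel: "U n \<in> borel_measurable lborel" for n
  proof -
    define \<gamma> where "\<gamma> = (\<lambda>t. g (of_real (r n) * cis t))"
    have "continuous_on UNIV \<gamma>" unfolding \<gamma>_def
      by (rule continuous_on_compose2[OF holomorphic_on_imp_continuous_on[OF g_holomorphic]])
        (use r01[of n] in \<open>auto intro!: continuous_intros simp: norm_mult\<close>)
    then have [measurable]: "\<gamma> \<in> borel_measurable borel" by (rule borel_measurable_continuous_onI)
    have "(\<lambda>t. V (sgn (\<gamma> t)) * indicator {0..2 * pi} t) \<in> borel_measurable lborel"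
      unfolding V_def ray_integral_def sgn_div_norm by measurable
    then show ?thesis by (simp add: U_def \<gamma>_def)
  qed
  have "ennreal (pi * R * v z / 12) \<le> limsup (\<lambda>n. integral\<^sup>N lborel (U n))"
    unfolding U_def V_def
    by (intro le_Limsup always_eventually allI averaged_circle_estimate[OF v R r C c z]) auto
  also have "\<dots> \<le> (\<integral>\<^sup>+t. limsup (\<lambda>n. U n t) \<partial>lborel)"
  proof (rule nn_integral_limsup[where w = "\<lambda>t. B * indicator {0..2 * pi} t"])
    show "AE t in lborel. U n t \<le> B * indicator {0..2 * pi} t" for n
      unfolding U_def by (intro AE_I2 mult_right_mono V_le) auto
    show "(\<integral>\<^sup>+t. B * indicator {0..2 * pi} t \<partial>lborel) < \<infinity>"
      using B_top by (simp add: nn_integral_cmult_indicator ennreal_mult_less_top)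
  qed (use U_borel in auto)
  also have "\<dots> \<le> (\<integral>\<^sup>+t. V (cis (\<mu> (t / pi))) * indicator {0<..<pi} t \<partial>lborel)"
  proof (rule nn_integral_mono_AE)
    show "AE t in lborel. limsup (\<lambda>n. U n t) \<le> V (cis (\<mu> (t / pi))) * indicator {0<..<pi} t"
      using AE_lborel_singleton[of 0] AE_lborel_singleton[of pi] AE_lborel_singleton[of "2 * pi"]
    proof eventually_elim
      case (elim t)
      then show ?case using lim[of t] by (cases "t \<in> {0..2 * pi}") (auto simp: U_def Limsup_const)
    qed
  qed
  also have "\<dots> = (\<integral>\<^sup>+t. \<integral>\<^sup>+s. ennreal (v (of_real s * cis (\<mu> (t / pi)))) * indicator {R / 8..2 * C * R} s * indicator {0<..<pi} t \<partial>lborel \<partial>lborel)"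
    unfolding V_def ray_integral_def by (subst nn_integral_multc) simp_all
  also have "\<dots> = (\<integral>\<^sup>+s. \<integral>\<^sup>+t. ennreal (v (of_real s * cis (\<mu> (t / pi)))) * indicator {R / 8..2 * C * R} s * indicator {0<..<pi} t \<partial>lborel \<partial>lborel)"
    by (subst lborel_pair.Fubini') simp_all
  also have "\<dots> = (\<integral>\<^sup>+s\<in>{R / 8..2 * C * R}. ennreal pi * (\<integral>\<^sup>+\<theta>\<in>{0<..<pi}. ennreal (v (of_real s * cis \<theta>)) \<partial>\<nu>) \<partial>lborel)"
  proof (rule nn_integral_cong)
    fix s
    define F where "F = (\<lambda>\<theta>. ennreal (v (of_real s * cis \<theta>)) * indicator {0<..<pi} \<theta>)"
    have "(\<integral>\<^sup>+t. ennreal (v (of_real s * cis (\<mu> (t / pi)))) * indicator {0<..<pi} t \<partial>lborel) =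
        ennreal pi * (\<integral>\<^sup>+x. ennreal (v (of_real s * cis (\<mu> ((0 + pi * x) / pi)))) * indicator {0<..<pi} (0 + pi * x) \<partial>lborel)"
      using nn_integral_real_affine[of "\<lambda>t. ennreal (v (of_real s * cis (\<mu> (t / pi)))) * indicator {0<..<pi} t" pi 0] by simp
    also have "(\<integral>\<^sup>+x. ennreal (v (of_real s * cis (\<mu> ((0 + pi * x) / pi)))) * indicator {0<..<pi} (0 + pi * x) \<partial>lborel) =
        (\<integral>\<^sup>+x\<in>{0<..<1}. F (\<mu> x) \<partial>lborel)"
      by (intro nn_integral_cong) (use \<mu>_interior in \<open>auto simp: F_def zero_less_mult_iff split: split_indicator\<close>)
    also have "\<dots> = (\<integral>\<^sup>+\<theta>. F \<theta> \<partial>\<nu>)"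
      by (rule nn_integral_\<nu>[symmetric]) (simp add: F_def)
    finally have "(\<integral>\<^sup>+t. ennreal (v (of_real s * cis (\<mu> (t / pi)))) * indicator {0<..<pi} t \<partial>lborel) =
        ennreal pi * (\<integral>\<^sup>+\<theta>. F \<theta> \<partial>\<nu>)" .
    then show "(\<integral>\<^sup>+t. ennreal (v (of_real s * cis (\<mu> (t / pi)))) * indicator {R / 8..2 * C * R} s * indicator {0<..<pi} t \<partial>lborel) =
        ennreal pi * (\<integral>\<^sup>+\<theta>\<in>{0<..<pi}. ennreal (v (of_real s * cis \<theta>)) \<partial>\<nu>) * indicator {R / 8..2 * C * R} s"
      by (cases "s \<in> {R / 8..2 * C * R}") (simp_all add: F_def)
  qed
  finally show ?thesis .
qed

text \<open>
  For given \<open>z\<close> the scale is \<open>R = 2 \<bar>z\<bar> / c\<close>, so that \<open>z\<close> lies in the covered disc; the averages of means of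
  size \<open>\<eta> s\<close> over \<open>s \<le> 2 C R\<close> give \<open>v z \<le> 48 C\<^sup>2 \<eta> R\<close>, which determines the choice of \<open>\<eta>\<close>.
\<close>
lemma growth_from_\<nu>_means:
  assumes v: "nn_subharmonic v" and low: "\<And>z. Im z \<le> 0 \<Longrightarrow> v z = 0"
    and means: "\<And>\<epsilon>. \<epsilon> > 0 \<Longrightarrow> \<exists>s0. \<forall>s\<ge>s0. (\<integral>\<^sup>+\<theta>\<in>{0<..<pi}. ennreal (v (of_real s * cis \<theta>)) \<partial>\<nu>) \<le> ennreal (\<epsilon> * s)"
    and \<epsilon>: "\<epsilon> > 0"
  shows "\<exists>\<rho>. \<forall>z. cmod z \<ge> \<rho> \<longrightarrow> v z \<le> \<epsilon> * cmod z"
proof -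
  obtain C where C: "C \<ge> 1" "\<And>w. cmod w < 1 \<Longrightarrow> cmod (g w) \<le> C" by (rule norm_g_bounded) blast
  obtain c where c: "c > 0" "ball 0 c \<subseteq> g ` ball 0 (1/4)" by (rule g_image_contains_ball[of "1/4"]) auto
  define \<eta> where "\<eta> = \<epsilon> * c / (96 * C\<^sup>2)"
  have \<eta>: "\<eta> > 0" using \<epsilon> c C by (simp add: \<eta>_def)
  obtain s0 where s0: "\<And>s. s \<ge> s0 \<Longrightarrow> (\<integral>\<^sup>+\<theta>\<in>{0<..<pi}. ennreal (v (of_real s * cis \<theta>)) \<partial>\<nu>) \<le> ennreal (\<eta> * s)"
    using means[OF \<eta>] by auto
  show ?thesis
  proof (intro exI[of _ "max 1 (4 * c * s0)"] allI impI)
    fix z assume z: "max 1 (4 * c * s0) \<le> cmod z"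
    define R where "R = 2 * cmod z / c"
    have z0: "cmod z > 0" using z by linarith
    have R: "R > 0" "cmod z < c * R" using z0 c by (simp_all add: R_def del: zero_less_norm_iff)
    have Rs: "s0 \<le> R / 8" using z c by (simp add: R_def field_simps)
    have "ennreal (pi * R * v z / 12) \<le>
      (\<integral>\<^sup>+s\<in>{R / 8..2 * C * R}. ennreal pi * (\<integral>\<^sup>+\<theta>\<in>{0<..<pi}. ennreal (v (of_real s * cis \<theta>)) \<partial>\<nu>) \<partial>lborel)"
      by (rule subharmonic_le_averaged_\<nu>_integral[OF v low R(1) C(2) c(2) R(2)])
    also have "\<dots> \<le> (\<integral>\<^sup>+s. ennreal (pi * \<eta> * (2 * C * R)) * indicator {0..2 * C * R} s \<partial>lborel)"
    proof (rule nn_integral_mono)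
      fix s
      show "ennreal pi * (\<integral>\<^sup>+\<theta>\<in>{0<..<pi}. ennreal (v (of_real s * cis \<theta>)) \<partial>\<nu>) * indicator {R / 8..2 * C * R} s
          \<le> ennreal (pi * \<eta> * (2 * C * R)) * indicator {0..2 * C * R} s"
      proof (cases "s \<in> {R / 8..2 * C * R}")
        case True
        have "ennreal pi * (\<integral>\<^sup>+\<theta>\<in>{0<..<pi}. ennreal (v (of_real s * cis \<theta>)) \<partial>\<nu>) \<le> ennreal pi * ennreal (\<eta> * s)"
          using True Rs by (intro mult_left_mono s0) auto
        also have "\<dots> \<le> ennreal pi * ennreal (\<eta> * (2 * C * R))"
          using True \<eta> by (intro mult_left_mono ennreal_leI) auto
        also have "\<dots> = ennreal (pi * \<eta> * (2 * C * R))" by (simp add: ennreal_mult'[symmetric] mult.assoc)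
        finally show ?thesis using True R by simp
      qed simp
    qed
    also have "\<dots> = ennreal (pi * \<eta> * (2 * C * R)) * ennreal (2 * C * R)"
      using C R by (subst nn_integral_cmult_indicator) (auto simp: emeasure_lborel_Icc_eq)
    also have "\<dots> = ennreal (pi * \<eta> * (2 * C * R) * (2 * C * R))"
      using C R by (subst ennreal_mult''[symmetric]) auto
    finally have "pi * R * v z / 12 \<le> pi * \<eta> * (2 * C * R) * (2 * C * R)"
      using C R \<eta> by (subst (asm) ennreal_le_iff) auto
    also have "\<dots> = (pi * R / 12) * (48 * C\<^sup>2 * \<eta> * R)" by (simp add: power2_eq_square)
    finally have "(pi * R / 12) * v z \<le> (pi * R / 12) * (48 * C\<^sup>2 * \<eta> * R)" by simp
    then have "v z \<le> 48 * C\<^sup>2 * \<eta> * R" using R by (subst (asm) mult_le_cancel_left_pos) auto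
    also have "\<dots> = \<epsilon> * cmod z" using C c by (simp add: \<eta>_def R_def field_simps)
    finally show "v z \<le> \<epsilon> * cmod z" .
  qed
qed

end

theorem theorem2:
  fixes \<nu> :: "real measure" and u :: "complex \<Rightarrow> ereal"
  assumes "\<nu> \<in> class_A 0 pi"
    and "subharmonic_on upper_half_plane u"
    and "\<forall>x0::real. Limsup (at (complex_of_real x0) within upper_half_plane) u \<le> 0"
    and "((\<lambda>t::real. ennreal (1 / t) *
            (\<integral>\<^sup>+ \<theta> \<in> {0<..<pi}. e2ennreal (max (u (of_real t * cis \<theta>)) 0) \<partial>\<nu>))
          \<longlongrightarrow> 0) at_top"
  shows "\<forall>z \<in> upper_half_plane. u z \<le> 0"
proof
  fix z assume z: "z \<in> upper_half_plane"
  interpret class_A_measure \<nu> by unfold_locales (rule assms(1))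
  define v where "v = pos_part_ext u"
  have v: "nn_subharmonic v" unfolding v_def by (rule nn_subharmonic_pos_part_ext[OF assms(2,3)])
  have low: "v z = 0" if "Im z \<le> 0" for z using that by (simp add: v_def pos_part_ext_def)
  have means: "\<exists>s0. \<forall>s\<ge>s0. (\<integral>\<^sup>+\<theta>\<in>{0<..<pi}. ennreal (v (of_real s * cis \<theta>)) \<partial>\<nu>) \<le> ennreal (\<epsilon> * s)"
    if \<epsilon>: "\<epsilon> > 0" for \<epsilon>
  proof -
    have "\<forall>\<^sub>F s in at_top. ennreal (1 / s) * (\<integral>\<^sup>+ \<theta> \<in> {0<..<pi}. e2ennreal (max (u (of_real s * cis \<theta>)) 0) \<partial>\<nu>) < ennreal \<epsilon>"
      using \<epsilon> by (intro order_tendstoD(2)[OF assms(4)]) simp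
    then have "\<forall>\<^sub>F s in at_top. (\<integral>\<^sup>+\<theta>\<in>{0<..<pi}. ennreal (v (of_real s * cis \<theta>)) \<partial>\<nu>) \<le> ennreal (\<epsilon> * s)"
      using eventually_gt_at_top[of 0]
    proof eventually_elim
      case (elim s)
      have "ennreal (v (of_real s * cis \<theta>)) * indicator {0<..<pi} \<theta> =
          e2ennreal (max (u (of_real s * cis \<theta>)) 0) * indicator {0<..<pi} \<theta>" for \<theta>
        using elim ennreal_pos_part_ext[OF assms(2), of "of_real s * cis \<theta>"]
        by (auto simp: v_def sin_gt_zero split: split_indicator)
      then have "(\<integral>\<^sup>+\<theta>\<in>{0<..<pi}. ennreal (v (of_real s * cis \<theta>)) \<partial>\<nu>) =
          1 * (\<integral>\<^sup>+ \<theta> \<in> {0<..<pi}. e2ennreal (max (u (of_real s * cis \<theta>)) 0) \<partial>\<nu>)" by simp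
      also have "1 = ennreal s * ennreal (1 / s)" using elim by (simp add: ennreal_mult'[symmetric])
      also have "ennreal s * ennreal (1 / s) * (\<integral>\<^sup>+ \<theta> \<in> {0<..<pi}. e2ennreal (max (u (of_real s * cis \<theta>)) 0) \<partial>\<nu>) \<le>
          ennreal s * ennreal \<epsilon>"
        using elim unfolding mult.assoc by (intro mult_left_mono) auto
      also have "\<dots> = ennreal (\<epsilon> * s)" using elim(2) by (subst ennreal_mult'[symmetric]) (simp_all add: mult.commute)
      finally show ?case .
    qed
    then show ?thesis by (simp add: eventually_at_top_linorder)
  qed
  have "v z = 0"
    by (rule phragmen_lindelof_half_plane[OF v low growth_from_\<nu>_means[OF v low means]])
  then have "max (u z) 0 = 0"
    using ereal_pos_part_ext[OF assms(2), of z] z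
    by (simp add: v_def upper_half_plane_def zero_ereal_def[symmetric])
  then show "u z \<le> 0" by (metis max.cobounded1)
qed

end
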